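(* Let $G=(V,E)$ be a connected, undirected, simple graph with $n$ vertices that contains a maximal 2-edge-connected component but is not itself a single maximal 2-edge-connected component, and let $I=(G,S,\Pi)$ be a feasible pebble permutation instance with $p\le n-2$ pebbles. Then for every $1\le i\le p$, pebbles $i$ and $\Pi(i)$ are equivalent with respect to $S$.
   Context: A maximal 2-edge-connected component of $G$ is a subgraph with at least two vertices that stays connected after deleting any single edge and is not contained in any larger such subgraph. Pebbles are labeled $1,\dots,p$. A configuration is an injective map $S:\{1,\dots,p\}\to V$, written $S=\langle s_1,\dots,s_p\rangle$. A move is a pair of configurations differing at exactly one pebble $k$, with $(s_k,s_k')\in E$. Two configurations are connected if one is obtained from the other by a finite sequence of moves. A pebble permutation instance $(G,S,\Pi)$, with $\Pi$ a permutation of $\{1,\dots,p\}$, is feasible if $S$ is connected to the configuration $D$ with $d_i=s_{\Pi(i)}$ for all $i$. Pebbles $i,j$ are equivalent with respect to $S$ if $i=j$ or $S$ is connected to a configuration $S'$ with $s'_i=s_j$, $s'_j=s_i$ and $s'_k=s_k$ for all $k\ne i,j$. *)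

theory Defs
  imports "Graph_Theory.Digraph_Component" "Graph_Theory.Pair_Digraph" "HOL-Combinatorics.Permutations"
    "HOL-Library.FuncSet"
begin

text \<open>
  Finite simple undirected graphs are the loop-free symmetric digraphs \<^const>\<open>pair_graph\<close>:
  the undirected edge between \<open>u\<close> and \<open>v\<close> is the pair of arcs \<open>(u, v)\<close>, \<open>(v, u)\<close>.
  Deleting an edge therefore removes both arcs.
\<close>

definition delete_edge :: "'a pair_pre_digraph \<Rightarrow> 'a \<Rightarrow> 'a \<Rightarrow> 'a pair_pre_digraph" where
  "delete_edge G u v = G\<lparr>parcs := parcs G - {(u, v), (v, u)}\<rparr>"

definition two_edge_connected :: "'a pair_pre_digraph \<Rightarrow> bool" where
  "two_edge_connected G \<longleftrightarrow>
     pair_graph G \<and> card (pverts G) \<ge> 2 \<and> Digraph_Component.connected (with_proj G) \<and>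
     (\<forall>(u, v) \<in> parcs G. Digraph_Component.connected (with_proj (delete_edge G u v)))"

definition max_two_edge_connected_component ::
    "'a pair_pre_digraph \<Rightarrow> 'a pair_pre_digraph \<Rightarrow> bool" where
  "max_two_edge_connected_component H G \<longleftrightarrow>
     subgraph (with_proj H) (with_proj G) \<and> two_edge_connected H \<and>
     (\<forall>H'. subgraph (with_proj H') (with_proj G) \<and> two_edge_connected H' \<and>
           subgraph (with_proj H) (with_proj H') \<longrightarrow> H' = H)"

text \<open>
  Configurations are extensional (\<^const>\<open>undefined\<close> outside \<open>{1..p}\<close>), so that equality of
  functions is equality of configurations.
\<close>

definition configs :: "'a pair_pre_digraph \<Rightarrow> nat \<Rightarrow> (nat \<Rightarrow> 'a) set" where
  "configs G p = {S \<in> {1..p} \<rightarrow>\<^sub>E pverts G. inj_on S {1..p}}"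

definition moves :: "'a pair_pre_digraph \<Rightarrow> nat \<Rightarrow> ((nat \<Rightarrow> 'a) \<times> (nat \<Rightarrow> 'a)) set" where
  "moves G p = {(S, S'). S \<in> configs G p \<and> S' \<in> configs G p \<and>
     (\<exists>k\<in>{1..p}. S k \<noteq> S' k \<and> (\<forall>j\<in>{1..p} - {k}. S j = S' j) \<and> (S k, S' k) \<in> parcs G)}"

definition config_connected ::
    "'a pair_pre_digraph \<Rightarrow> nat \<Rightarrow> (nat \<Rightarrow> 'a) \<Rightarrow> (nat \<Rightarrow> 'a) \<Rightarrow> bool" where
  "config_connected G p S T \<longleftrightarrow>
     S \<in> configs G p \<and> T \<in> configs G p \<and> (S, T) \<in> (moves G p)\<^sup>*"

definition feasible ::
    "'a pair_pre_digraph \<Rightarrow> nat \<Rightarrow> (nat \<Rightarrow> 'a) \<Rightarrow> (nat \<Rightarrow> nat) \<Rightarrow> bool" where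
  "feasible G p S \<pi> \<longleftrightarrow> config_connected G p S (\<lambda>i\<in>{1..p}. S (\<pi> i))"

definition pebble_equiv ::
    "'a pair_pre_digraph \<Rightarrow> nat \<Rightarrow> (nat \<Rightarrow> 'a) \<Rightarrow> nat \<Rightarrow> nat \<Rightarrow> bool" where
  "pebble_equiv G p S i j \<longleftrightarrow> i = j \<or>
     (\<exists>S'. config_connected G p S S' \<and> S' i = S j \<and> S' j = S i \<and>
           (\<forall>k\<in>{1..p} - {i, j}. S' k = S k))"

end

theory Submission
  imports Defs
begin

text \<open>
  Record a configuration by the label at each vertex, with \<open>0\<close> for a hole; a move transposes the
  contents of two adjacent vertices, one of which is a hole. Two labels are interchangeable if their
  transposition is realizable; this is an equivalence relation, invariant under moves.

  Claim: the content of every vertex, modulo interchangeability, depends only on the set of holes.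
  Applied to a feasible permutation this gives the theorem.

  For walks along the edges of a tree the claim follows by induction on adding a leaf \<open>v\<close> at a
  vertex \<open>w\<close>. A pebble that leaves \<open>v\<close>, while another one later enters, can be left at \<open>v\<close> instead:
  the only obstruction is a hole crossing \<open>w\<close> meanwhile, and then two branches at \<open>w\<close> have holes and
  the two pebbles concerned can be exchanged in the star around \<open>w\<close>.

  In general take a spanning tree. A move along a further edge differs from shifting the hole along
  the tree path by a rotation of the pebbles on a cycle. That cycle misses a vertex, since a
  Hamiltonian cycle would make the graph 2-edge-connected. As there is a second hole, one can arrange
  a hole on the cycle next to a vertex that has a hole as neighbour off the cycle; there two
  consecutive pebbles of the cycle can be exchanged, and by rotating any two.
\<close>

section \<open>Moving holes\<close>

text \<open>Only \<open>x\<close> has to be a hole: if \<open>y\<close> is one as well, the step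
  changes nothing. Moves compose with \<open>c\<close> on the right and renamings of pebbles on the
  left, so the two commute.\<close>

definition hole_step :: "('a \<times> 'a) set \<Rightarrow> (('a \<Rightarrow> 'b::zero) \<times> ('a \<Rightarrow> 'b)) set" where
  "hole_step E = {(c, c \<circ> transpose x y) | c x y. (x, y) \<in> E \<and> c x = 0}"

abbreviation reach :: "('a \<times> 'a) set \<Rightarrow> ('a \<Rightarrow> 'b::zero) \<Rightarrow> ('a \<Rightarrow> 'b) \<Rightarrow> bool" where
  "reach E c d \<equiv> (c, d) \<in> (hole_step E)\<^sup>*"

abbreviation holes :: "('a \<Rightarrow> 'b::zero) \<Rightarrow> 'a set" where
  "holes c \<equiv> {v. c v = 0}"

lemma hole_stepI: "(x, y) \<in> E \<Longrightarrow> c x = 0 \<Longrightarrow> (c, c \<circ> transpose x y) \<in> hole_step E"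
  unfolding hole_step_def by blast

lemma hole_stepE:
  assumes "(c, d) \<in> hole_step E"
  obtains x y where "(x, y) \<in> E" "c x = 0" "d = c \<circ> transpose x y"
  using assms unfolding hole_step_def by blast

lemma reach_step: "(x, y) \<in> E \<Longrightarrow> c x = 0 \<Longrightarrow> reach E c (c \<circ> transpose x y)"
  by (blast intro: hole_stepI)

lemma reach_mono: "reach F c d \<Longrightarrow> F \<subseteq> E \<Longrightarrow> reach E c d"
  by (rule subsetD[OF rtrancl_mono]) (auto simp: hole_step_def)

lemma reach_sym:
  assumes "sym E" "reach E c d"
  shows "reach E d c"
proof -
  have "sym (hole_step E :: (('a \<Rightarrow> 'b) \<times> ('a \<Rightarrow> 'b)) set)"
  proof (rule symI)
    fix c d :: "'a \<Rightarrow> 'b" assume "(c, d) \<in> hole_step E"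
    then obtain x y where "(x, y) \<in> E" "c x = 0" "d = c \<circ> transpose x y"
      by (rule hole_stepE)
    then have "(y, x) \<in> E" "d y = 0" "c = d \<circ> transpose y x"
      using assms(1) by (auto simp: sym_def fun_eq_iff transpose_commute)
    then show "(d, c) \<in> hole_step E"
      using hole_stepI by metis
  qed
  from symD[OF sym_rtrancl[OF this] assms(2)] show ?thesis .
qed

text \<open>Whether a walk is legal depends on the holes alone, never on which pebble stands where.
  So the same permutation of positions can be executed from every arrangement with these
  holes.\<close>

lemma reach_permutes:
  fixes c d :: "'a \<Rightarrow> 'b::zero"
  assumes "reach E c d" "E \<subseteq> A \<times> A"
  obtains g where "g permutes A" "d = c \<circ> g"
    "\<And>c' :: 'a \<Rightarrow> 'b. holes c' = holes c \<Longrightarrow> reach E c' (c' \<circ> g)"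
proof -
  have "\<exists>g. g permutes A \<and> d = c \<circ> g \<and>
      (\<forall>c' :: 'a \<Rightarrow> 'b. holes c' = holes c \<longrightarrow> reach E c' (c' \<circ> g))"
    using assms(1)
  proof (induction rule: rtrancl_induct)
    case base
    have "reach E c' (c' \<circ> id)" for c' :: "'a \<Rightarrow> 'b" by simp
    moreover have "c = c \<circ> id" by simp
    ultimately show ?case using permutes_id[of A] by blast
  next
    case (step d e)
    then obtain g where g: "g permutes A" "d = c \<circ> g"
      "\<And>c' :: 'a \<Rightarrow> 'b. holes c' = holes c \<Longrightarrow> reach E c' (c' \<circ> g)" by blast
    obtain x y where xy: "(x, y) \<in> E" "d x = 0" "e = d \<circ> transpose x y"
      using step.hyps(2) by (rule hole_stepE)
    have "g \<circ> transpose x y permutes A"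
      using xy(1) assms(2) by (intro permutes_compose permutes_swap_id g(1)) auto
    moreover have "reach E c' (c' \<circ> (g \<circ> transpose x y))" if "holes c' = holes c" for c' :: "'a \<Rightarrow> 'b"
    proof -
      have "(c' \<circ> g) x = 0" using that xy(2) g(2) by auto
      then show ?thesis
        using g(3)[OF that] reach_step[OF xy(1), of "c' \<circ> g"] by (simp add: comp_assoc)
    qed
    moreover have "e = c \<circ> (g \<circ> transpose x y)" using xy(3) g(2) by (simp add: comp_assoc)
    ultimately show ?case by blast
  qed
  then show ?thesis using that by blast
qed

lemma reach_card_holes:
  assumes "reach E c d" "E \<subseteq> A \<times> A"
  shows "card (holes d \<inter> A) = card (holes c \<inter> A)"
proof -
  obtain g where g: "g permutes A" "d = c \<circ> g" using assms by (rule reach_permutes)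
  have "bij_betw g (holes d \<inter> A) (holes c \<inter> A)"
  proof (rule bij_betw_imageI)
    have "holes d \<inter> A = g -` (holes c \<inter> A)"
      using g(2) permutes_in_image[OF g(1)] by auto
    then show "g ` (holes d \<inter> A) = holes c \<inter> A"
      using surj_image_vimage_eq[OF permutes_surj[OF g(1)]] by metis
  qed (rule permutes_inj_on[OF g(1)])
  then show ?thesis by (rule bij_betw_same_card)
qed

lemma reach_relabel:
  assumes "reach E c d" "\<sigma> 0 = 0"
  shows "reach E (\<sigma> \<circ> c) (\<sigma> \<circ> d)"
  using assms(1)
proof (induction rule: rtrancl_induct)
  case (step d e)
  then obtain x y where "(x, y) \<in> E" "d x = 0" "e = d \<circ> transpose x y"
    by (auto elim: hole_stepE)
  then have "(\<sigma> \<circ> d, \<sigma> \<circ> e) \<in> hole_step E"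
    using hole_stepI[of x y E "\<sigma> \<circ> d"] assms(2) by (simp add: comp_assoc)
  then show ?case using step.IH by (rule rtrancl_into_rtrancl[rotated])
qed blast

section \<open>Carrying holes along paths\<close>

lemma holes_comp_transpose:
  "c x = 0 \<Longrightarrow> c y \<noteq> 0 \<Longrightarrow> holes (c \<circ> transpose x y) = insert y (holes c - {x})"
  by (auto simp: transpose_def)

text \<open>The relation \<open>M\<close> and the invariant \<open>P\<close> are left open so that
  the argument serves for ordinary walks and for walks in \<open>parked\<close>.\<close>

lemma transport_hole:
  assumes "(x, y) \<in> R\<^sup>*" and "trans M"
    and "\<And>c x y. \<lbrakk>P c; (x, y) \<in> R; c x = 0; c y \<noteq> 0\<rbrakk> \<Longrightarrow>
      \<exists>d. (c, d) \<in> M \<and> P d \<and> holes d = insert y (holes c - {x})"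
    and "P c" "c x = 0" "c y \<noteq> 0"
  shows "\<exists>d. (c, d) \<in> M \<and> P d \<and> holes d = insert y (holes c - {x})"
  using assms(1,4-6)
proof (induction arbitrary: c rule: converse_rtrancl_induct)
  case base
  then show ?case by simp
next
  case (step x x')
  show ?case
  proof (cases "c x' = 0")
    case True
    \<comment> \<open>The next vertex \<open>x'\<close> is itself a hole: that hole travels on to
      \<open>y\<close> first, and the one at \<open>x\<close> then takes its place.\<close>
    then obtain d where d: "(c, d) \<in> M" "P d" "holes d = insert y (holes c - {x'})"
      using step by blast
    show ?thesis
    proof (cases "x = x'")
      case False
      have "d x = 0" "d x' \<noteq> 0" using d(3) step.prems True False by auto
      then obtain e where "(d, e) \<in> M" "P e" "holes e = insert x' (holes d - {x})"
        using assms(3)[OF d(2) step.hyps(1)] by blast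
      moreover from this have "holes e = insert y (holes c - {x})"
        using d(3) step.prems True False by auto
      ultimately show ?thesis using d(1) \<open>trans M\<close> by (meson transD)
    qed (use d in blast)
  next
    case False
    then obtain d where d: "(c, d) \<in> M" "P d" "holes d = insert x' (holes c - {x})"
      using assms(3)[OF step.prems(1) step.hyps(1)] step.prems by blast
    show ?thesis
    proof (cases "x' = y")
      case False
      then have "d x' = 0" "d y \<noteq> 0" using d(3) step.prems by auto
      then obtain e where "(d, e) \<in> M" "P e" "holes e = insert y (holes d - {x'})"
        using step.IH[OF d(2)] by blast
      moreover from this have "holes e = insert y (holes c - {x})"
        using d(3) \<open>c x' \<noteq> 0\<close> by auto
      ultimately show ?thesis using d(1) \<open>trans M\<close> by (meson transD)
    qed (use d in blast)
  qed
qed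

lemma reach_transport_hole:
  assumes "(x, y) \<in> F\<^sup>*" "c x = 0" "c y \<noteq> 0"
  obtains d where "reach F c d" "holes d = insert y (holes c - {x})"
proof -
  have "\<exists>d. (c, d) \<in> (hole_step F)\<^sup>* \<and> True \<and> holes d = insert y (holes c - {x})"
  proof (rule transport_hole[OF assms(1) trans_rtrancl, where P = "\<lambda>_. True"])
    fix c :: "'a \<Rightarrow> 'b" and x y
    assume "(x, y) \<in> F" "c x = 0" "c y \<noteq> 0"
    then show "\<exists>d. reach F c d \<and> True \<and> holes d = insert y (holes c - {x})"
      using reach_step[of x y F c] holes_comp_transpose[of c x y] by blast
  qed (use assms in simp_all)
  then show ?thesis using that by blast
qed

text \<open>Each round carries a hole from outside \<open>W\<close> to a vertex of \<open>W\<close>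
  that is still occupied. As the numbers agree, a missing target always comes with a surplus
  hole.\<close>

lemma redistribute_holes:
  assumes "finite A" "\<And>x y. x \<in> A \<Longrightarrow> y \<in> A \<Longrightarrow> (x, y) \<in> R\<^sup>*"
    and "refl M" "trans M"
    and "\<And>c x y. \<lbrakk>P c; (x, y) \<in> R; c x = 0; c y \<noteq> 0\<rbrakk> \<Longrightarrow>
      \<exists>d. (c, d) \<in> M \<and> P d \<and> holes d = insert y (holes c - {x})"
    and "P c" "W \<subseteq> A" "card (holes c \<inter> A) = card W"
  shows "\<exists>d. (c, d) \<in> M \<and> P d \<and> holes d \<inter> A = W \<and> holes d - A = holes c - A"
  using assms(6-8)
proof (induction "card (W - holes c)" arbitrary: c)
  case 0
  then have "W \<subseteq> holes c \<inter> A" using assms(1) by (auto simp: finite_subset)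
  then have "holes c \<inter> A = W"
    using 0 assms(1) by (metis card_subset_eq finite_Int)
  then show ?case using 0 \<open>refl M\<close> by (auto simp: refl_on_def)
next
  case (Suc m)
  have fin: "finite W" using Suc.prems assms(1) by (auto simp: finite_subset)
  obtain y where y: "y \<in> W" "c y \<noteq> 0" using Suc.hyps(2)
    by (metis (mono_tags, lifting) Diff_eq_empty_iff card.empty mem_Collect_eq nat.distinct(1) subsetI)
  have "\<not> holes c \<inter> A \<subseteq> W"
    using y Suc.prems fin by (metis (mono_tags, lifting) IntD1 card_subset_eq mem_Collect_eq)
  then obtain x where x: "x \<in> A" "x \<notin> W" "c x = 0" by blast
  have "(x, y) \<in> R\<^sup>*" using x y Suc.prems assms(2) by blast
  then obtain d where d: "(c, d) \<in> M" "P d" "holes d = insert y (holes c - {x})"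
    using transport_hole[OF _ assms(4,5)] Suc.prems(1) x(3) y(2) by blast
  have "W - holes d = (W - holes c) - {y}" using d(3) x by auto
  then have "m = card (W - holes d)" using Suc.hyps(2) y fin by simp
  moreover have "holes d \<inter> A = insert y (holes c \<inter> A - {x})"
    using d(3) y Suc.prems by auto
  then have "card (holes d \<inter> A) = card W"
    using x y Suc.prems fin assms(1) card_gt_0_iff[of W] by auto
  ultimately obtain e where e: "(d, e) \<in> M" "P e" "holes e \<inter> A = W" "holes e - A = holes d - A"
    using Suc.hyps(1)[of d] d(2) Suc.prems(2) by blast
  have "holes d - A = holes c - A" using d(3) x y Suc.prems(2) by auto
  then show ?case using e transD[OF \<open>trans M\<close> d(1) e(1)] by auto
qed

text \<open>
  The contents of \<open>u\<close> and \<open>z\<close> are exchanged by letting them wait at \<open>x\<close> and \<open>y\<close>; they may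
  themselves be holes.
\<close>

lemma reach_star_swap:
  assumes "sym E" "(u, x) \<in> E" "(u, y) \<in> E" "(u, z) \<in> E"
    and "u \<noteq> x" "u \<noteq> y" "u \<noteq> z" "x \<noteq> y" "x \<noteq> z" "y \<noteq> z"
    and "c x = 0" "c y = 0"
  shows "reach E c (c \<circ> transpose u z)"
proof -
  have E: "(x, u) \<in> E" "(y, u) \<in> E" "(z, u) \<in> E" using assms by (auto dest: symD)
  define c1 where "c1 = c \<circ> transpose x u"
  define c2 where "c2 = c1 \<circ> transpose u z"
  define c3 where "c3 = c2 \<circ> transpose y u"
  define c4 where "c4 = c3 \<circ> transpose u x"
  define c5 where "c5 = c4 \<circ> transpose z u"
  define c6 where "c6 = c5 \<circ> transpose u y"
  have 1: "reach E c c1" unfolding c1_def using assms E by (intro reach_step) auto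
  have 2: "reach E c1 c2" unfolding c2_def
    using assms E by (intro reach_step) (auto simp: c1_def)
  have 3: "reach E c2 c3" unfolding c3_def
    using assms E by (intro reach_step) (auto simp: c1_def c2_def)
  have 4: "reach E c3 c4" unfolding c4_def
    using assms E by (intro reach_step) (auto simp: c1_def c2_def c3_def)
  have 5: "reach E c4 c5" unfolding c5_def
    using assms E by (intro reach_step) (auto simp: c1_def c2_def c3_def c4_def)
  have 6: "reach E c5 c6" unfolding c6_def
    using assms E by (intro reach_step) (auto simp: c1_def c2_def c3_def c4_def c5_def)
  have "c6 = c \<circ> transpose u z"
    unfolding c6_def c5_def c4_def c3_def c2_def c1_def fun_eq_iff
    using assms by (auto simp: transpose_def)
  then show ?thesis using 1 2 3 4 5 6 by (meson rtrancl_trans)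
qed

section \<open>Interchangeable pebbles and growing a tree by a leaf\<close>

locale pebbling =
  fixes E :: "('a \<times> 'a) set" and c\<^sub>0 :: "'a \<Rightarrow> 'b::zero"
  assumes sym_E: "sym E" and inj_labels: "inj_on c\<^sub>0 {v. c\<^sub>0 v \<noteq> 0}"
begin

text \<open>Label \<open>0\<close> is equivalent to itself only, so congruent arrangements have the
  same holes. The exchange is tested at \<open>c\<^sub>0\<close>;
  \<open>swappable_if_reach_transpose\<close> frees it from this starting point.\<close>

definition swappable :: "'b \<Rightarrow> 'b \<Rightarrow> bool" (infix \<open>\<approx>\<close> 50) where
  "i \<approx> j \<longleftrightarrow> i = j \<or> i \<noteq> 0 \<and> j \<noteq> 0 \<and> reach E c\<^sub>0 (transpose i j \<circ> c\<^sub>0)"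

definition congruent_mod :: "('a \<Rightarrow> 'b) \<Rightarrow> ('a \<Rightarrow> 'b) \<Rightarrow> bool" (infix \<open>\<cong>\<close> 50) where
  "c \<cong> d \<longleftrightarrow> (\<forall>v. c v \<approx> d v)"

lemma swappable_sym: "i \<approx> j \<Longrightarrow> j \<approx> i"
  unfolding swappable_def by (auto simp: transpose_commute)

text \<open>Conjugating the exchange of \<open>j\<close> and \<open>k\<close> by that of
  \<open>i\<close> and \<open>j\<close> gives the exchange of \<open>i\<close> and \<open>k\<close>.
  Relabeled walks perform the three exchanges one after another.\<close>

lemma swappable_trans:
  assumes "i \<approx> j" "j \<approx> k"
  shows "i \<approx> k"
proof (cases "i = j \<or> j = k \<or> i = k")
  case False
  then have nz: "i \<noteq> 0" "j \<noteq> 0" "k \<noteq> 0"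
    and ij: "reach E c\<^sub>0 (transpose i j \<circ> c\<^sub>0)" and jk: "reach E c\<^sub>0 (transpose j k \<circ> c\<^sub>0)"
    using assms by (auto simp: swappable_def)
  have "reach E (transpose i j \<circ> c\<^sub>0) (transpose i j \<circ> (transpose j k \<circ> c\<^sub>0))"
    using nz by (intro reach_relabel jk) simp
  moreover have "reach E (transpose i j \<circ> transpose j k \<circ> c\<^sub>0)
      (transpose i j \<circ> transpose j k \<circ> (transpose i j \<circ> c\<^sub>0))"
    using nz by (intro reach_relabel ij) simp
  moreover have "transpose i j \<circ> transpose j k \<circ> (transpose i j \<circ> c\<^sub>0) = transpose i k \<circ> c\<^sub>0"
    using False by (auto simp: fun_eq_iff transpose_def)
  ultimately have "reach E c\<^sub>0 (transpose i k \<circ> c\<^sub>0)"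
    using ij by (simp add: comp_assoc)
  then show ?thesis using nz by (simp add: swappable_def)
qed (use assms in \<open>auto simp: swappable_def\<close>)

lemma swappable_zero: "i \<approx> j \<Longrightarrow> i = 0 \<longleftrightarrow> j = 0"
  by (auto simp: swappable_def)

lemma reach_inj_labels:
  assumes "reach E c\<^sub>0 c" "c x = c y" "c x \<noteq> 0"
  shows "x = y"
proof -
  obtain g where "g permutes UNIV" "c = c\<^sub>0 \<circ> g"
    using assms(1) by (elim reach_permutes[where A = UNIV]) auto
  then show ?thesis
    using assms inj_labels permutes_inj[of g UNIV] by (auto simp: inj_on_def)
qed

text \<open>In a reachable arrangement no pebble occurs twice, so exchanging two positions is
  exchanging two labels. Walking back to \<open>c\<^sub>0\<close> with the labels exchanged realizes
  the exchange there.\<close>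

lemma swappable_if_reach_transpose:
  assumes c: "reach E c\<^sub>0 c" and "reach E c (c \<circ> transpose x y)" "c x \<noteq> 0" "c y \<noteq> 0"
  shows "c x \<approx> c y"
proof -
  have "c \<circ> transpose x y = transpose (c x) (c y) \<circ> c"
  proof
    fix v
    show "(c \<circ> transpose x y) v = (transpose (c x) (c y) \<circ> c) v"
      using reach_inj_labels[OF c, of v x] reach_inj_labels[OF c, of v y] assms(3,4)
      by (auto simp: transpose_def)
  qed
  moreover have "reach E (transpose (c x) (c y) \<circ> c) (transpose (c x) (c y) \<circ> c\<^sub>0)"
    using assms(3,4) by (intro reach_relabel reach_sym[OF sym_E c]) simp
  ultimately have "reach E c\<^sub>0 (transpose (c x) (c y) \<circ> c\<^sub>0)"
    using assms(1,2) by simp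
  then show ?thesis using assms(3,4) by (simp add: swappable_def)
qed

lemma congruent_refl: "c \<cong> c"
  by (simp add: congruent_mod_def swappable_def)

lemma congruent_sym: "c \<cong> d \<Longrightarrow> d \<cong> c"
  by (auto simp: congruent_mod_def swappable_sym)

lemma congruent_trans: "c \<cong> d \<Longrightarrow> d \<cong> e \<Longrightarrow> c \<cong> e"
  unfolding congruent_mod_def by (blast intro: swappable_trans)

lemma congruent_comp: "c \<cong> d \<Longrightarrow> c \<circ> g \<cong> d \<circ> g"
  by (simp add: congruent_mod_def)

lemma congruent_zero: "c \<cong> d \<Longrightarrow> c v = 0 \<longleftrightarrow> d v = 0"
  using swappable_zero by (auto simp: congruent_mod_def)

lemma congruent_holes: "c \<cong> d \<Longrightarrow> holes c = holes d"
  using congruent_zero by blast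

lemma congruent_comp_transpose:
  assumes "c \<circ> transpose x y \<cong> d"
  shows "c \<cong> d \<circ> transpose x y"
  using congruent_comp[OF assms, of "transpose x y"] by (simp add: comp_assoc)

lemma reach_congruent:
  assumes "reach F c d" "c \<cong> c'"
  obtains d' where "reach F c' d'" "d \<cong> d'"
proof -
  obtain g where "d = c \<circ> g" "reach F c' (c' \<circ> g)"
    using assms(1) congruent_holes[OF assms(2)] by (elim reach_permutes[where A = UNIV]) auto
  then show ?thesis using that congruent_comp[OF assms(2)] by blast
qed

text \<open>Only the walk is confined to \<open>F\<close>; starting points and interchangeability
  refer to all of \<open>E\<close>. Thus the equivalence stays fixed while \<open>F\<close>
  grows.\<close>

definition rigid :: "('a \<times> 'a) set \<Rightarrow> bool" where
  "rigid F \<longleftrightarrow> (\<forall>c d. reach E c\<^sub>0 c \<longrightarrow> reach F c d \<longrightarrow> holes c = holes d \<longrightarrow> c \<cong> d)"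

lemma rigidD: "rigid F \<Longrightarrow> reach E c\<^sub>0 c \<Longrightarrow> reach F c d \<Longrightarrow> holes c = holes d \<Longrightarrow> c \<cong> d"
  by (auto simp: rigid_def)

section \<open>Adding a leaf \<open>v\<close> at \<open>w\<close> to a rigid edge set\<close>

context
  fixes F A v w
  assumes F: "F \<subseteq> E" "F \<subseteq> A \<times> A" "sym F" "irrefl F"
    and A: "finite A" "\<And>x y. x \<in> A \<Longrightarrow> y \<in> A \<Longrightarrow> (x, y) \<in> F\<^sup>*"
    and leaf: "w \<in> A" "v \<notin> A" "(v, w) \<in> E"
    and rigid_F: "rigid F"
begin

text \<open>
  \<open>(c, d) \<in> parked\<close>: the walk from \<open>c\<close> to \<open>d\<close> can be imitated, up to interchangeable labels, while the
  pebble at \<open>w\<close> is kept at the leaf \<open>v\<close>.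
\<close>

definition parked :: "('a \<Rightarrow> 'b) rel" where
  "parked = {(c, d). reach F c d \<and>
     (\<exists>e. reach F (c \<circ> transpose v w) e \<and> e \<circ> transpose v w \<cong> d)}"

text \<open>While \<open>w\<close> is occupied, a hole passes it by two steps in a row. Counting
  these as one keeps the vertices other than \<open>w\<close> connected even where \<open>w\<close>
  separates branches.\<close>

definition bypass :: "'a rel" where
  "bypass = {(x, y). x \<noteq> w \<and> y \<noteq> w \<and> ((x, y) \<in> F \<or> (x, w) \<in> F \<and> (w, y) \<in> F)}"

lemma reach_F_E: "reach E c\<^sub>0 c \<Longrightarrow> reach F c d \<Longrightarrow> reach E c\<^sub>0 d"
  using reach_mono[OF _ F(1)] by (meson rtrancl_trans)

lemma v_neq_w: "v \<noteq> w"
  using leaf by auto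

lemma w_v: "(w, v) \<in> E"
  using leaf(3) sym_E by (auto dest: symD)

lemma refl_parked: "refl parked"
proof (rule refl_onI)
  fix c
  have "c \<circ> transpose v w \<circ> transpose v w \<cong> c"
    by (simp add: comp_assoc congruent_refl)
  then show "(c, c) \<in> parked" unfolding parked_def by blast
qed

lemma trans_parked: "trans parked"
proof (rule transI)
  fix c d e
  assume "(c, d) \<in> parked" "(d, e) \<in> parked"
  then obtain d' e' where *: "reach F c d" "reach F (c \<circ> transpose v w) d'" "d' \<circ> transpose v w \<cong> d"
    "reach F d e" "reach F (d \<circ> transpose v w) e'" "e' \<circ> transpose v w \<cong> e"
    unfolding parked_def by blast
  have "d \<circ> transpose v w \<cong> d'"
    using congruent_comp_transpose[OF *(3)] by (rule congruent_sym)
  \<comment> \<open>The second imitation starts at an arrangement that is only congruent to the end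
    of the first, so it is copied there.\<close>
  from reach_congruent[OF *(5) this] obtain e'' where e'': "reach F d' e''" "e' \<cong> e''" .
  have "e'' \<circ> transpose v w \<cong> e"
    using congruent_comp[OF congruent_sym[OF e''(2)]] *(6) by (rule congruent_trans)
  moreover have "reach F (c \<circ> transpose v w) e''" "reach F c e"
    using * e'' by (meson rtrancl_trans)+
  ultimately show "(c, e) \<in> parked" unfolding parked_def by blast
qed

lemma bypass_connected:
  assumes "x \<in> A - {w}" "y \<in> A - {w}"
  shows "(x, y) \<in> bypass\<^sup>*"
proof -
  have "(x, y) \<in> F\<^sup>*" using assms A by blast
  \<comment> \<open>While the path stands at \<open>w\<close>, its previous vertex is remembered;
    one bypass step leads from there to the next vertex.\<close>
  then have "if y = w then \<exists>x'. (x, x') \<in> bypass\<^sup>* \<and> (x', w) \<in> F \<and> x' \<noteq> w else (x, y) \<in> bypass\<^sup>*"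
  proof (induction rule: rtrancl_induct)
    case base
    then show ?case using assms by auto
  next
    case (step y z)
    show ?case
    proof (cases "y = w")
      case True
      then have "z \<noteq> w" using step.hyps(2) F(4) by (auto simp: irrefl_def)
      obtain x' where "(x, x') \<in> bypass\<^sup>*" "(x', w) \<in> F" "x' \<noteq> w" using step.IH True by auto
      moreover from this have "(x', z) \<in> bypass"
        using True step.hyps(2) \<open>z \<noteq> w\<close> by (auto simp: bypass_def)
      ultimately show ?thesis using \<open>z \<noteq> w\<close> by (simp add: rtrancl.rtrancl_into_rtrancl)
    next
      case False
      show ?thesis
      proof (cases "z = w")
        case True
        then show ?thesis using False step by auto
      next
        case z: False
        then have "(y, z) \<in> bypass" using False step.hyps(2) by (auto simp: bypass_def)
        then show ?thesis using z False step.IH by (simp add: rtrancl.rtrancl_into_rtrancl)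
      qed
    qed
  qed
  then show ?thesis using assms by auto
qed

lemma parked_bypass_step:
  assumes c: "reach E c\<^sub>0 c" "c v = 0" "c w \<noteq> 0" and xy: "(x, y) \<in> bypass" "c x = 0" "c y \<noteq> 0"
  shows "\<exists>d. (c, d) \<in> parked \<and> (reach E c\<^sub>0 d \<and> d v = 0 \<and> d w \<noteq> 0) \<and> holes d = insert y (holes c - {x})"
proof -
  have neq: "x \<noteq> v" "y \<noteq> v" "x \<noteq> w" "y \<noteq> w" "x \<noteq> y"
    using xy F(2) leaf by (auto simp: bypass_def)
  consider "(x, y) \<in> F" | "(x, w) \<in> F" "(w, y) \<in> F" using xy by (auto simp: bypass_def)
  then show ?thesis
  proof cases
    case 1
    define d where "d = c \<circ> transpose x y"
    define e where "e = c \<circ> transpose v w \<circ> transpose x y"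
    have d: "reach F c d" unfolding d_def using 1 xy(2) by (rule reach_step)
    have e: "reach F (c \<circ> transpose v w) e" unfolding e_def using neq xy(2) 1 by (intro reach_step) auto
    have "e \<circ> transpose v w = d"
      unfolding e_def d_def using neq by (auto simp: fun_eq_iff transpose_def)
    then have "(c, d) \<in> parked" using d e congruent_refl unfolding parked_def by auto
    moreover have "d v = 0" "d w \<noteq> 0" using neq c by (auto simp: d_def)
    moreover have "holes d = insert y (holes c - {x})"
      unfolding d_def using xy by (intro holes_comp_transpose)
    ultimately show ?thesis using reach_F_E[OF c(1) d] by blast
  next
    \<comment> \<open>The hole crosses \<open>w\<close>. The walk itself leaves the pebble of
      \<open>w\<close> at \<open>x\<close> and that of \<open>y\<close> at \<open>w\<close>; with
      the former parked at \<open>v\<close>, the pebble of \<open>y\<close> ends at \<open>x\<close>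
      instead. The results differ by exchanging these two pebbles, which the star around
      \<open>w\<close> with holes \<open>v\<close> and \<open>x\<close> permits.\<close>
    case 2
    define t where "t = transpose v w"
    define d where "d = c \<circ> transpose x w \<circ> transpose w y"
    define e where "e = c \<circ> t \<circ> transpose w y \<circ> transpose x w"
    have "reach F c (c \<circ> transpose x w)" using 2 xy by (intro reach_step)
    moreover have "reach F (c \<circ> transpose x w) d"
      unfolding d_def using 2 xy by (intro reach_step) auto
    ultimately have d: "reach F c d" by (rule rtrancl_trans)
    have "reach F (c \<circ> t) (c \<circ> t \<circ> transpose w y)"
      using 2 c v_neq_w by (intro reach_step) (auto simp: t_def)
    moreover have "reach F (c \<circ> t \<circ> transpose w y) e"
      unfolding e_def using 2 xy neq by (intro reach_step) (auto simp: t_def)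
    ultimately have e: "reach F (c \<circ> t) e" by (rule rtrancl_trans)
    have "reach E c (c \<circ> transpose w y)"
      using sym_E w_v _ _ v_neq_w[symmetric] neq(3)[symmetric] neq(4)[symmetric] neq(1)[symmetric]
        neq(2)[symmetric] neq(5) c(2) xy(2)
      by (rule reach_star_swap) (use 2 F in \<open>auto dest: symD\<close>)
    then have sw: "c w \<approx> c y"
      using c xy by (intro swappable_if_reach_transpose)
    have "(e \<circ> t) z \<approx> d z" for z
      using sw swappable_sym[OF sw] neq v_neq_w
      by (auto simp: e_def d_def t_def transpose_def swappable_def c xy)
    then have "(c, d) \<in> parked"
      using d e unfolding parked_def congruent_mod_def t_def by auto
    moreover have "d v = 0" "d w \<noteq> 0" using neq c xy v_neq_w by (auto simp: d_def transpose_def)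
    moreover have "holes d = insert y (holes c - {x})"
      unfolding d_def using xy neq c by (auto simp: transpose_def)
    ultimately show ?thesis using reach_F_E[OF c(1) d] by blast
  qed
qed

text \<open>Some walk in \<open>parked\<close> produces the holes of \<open>d\<close>, and rigidity
  of \<open>F\<close> makes its end congruent to \<open>d\<close>. So an excursion in which the
  pebble of \<open>v\<close> steps to \<open>w\<close> and a pebble later enters \<open>v\<close>
  can be replaced by a walk that leaves \<open>v\<close> alone.\<close>

lemma parking_excursion:
  assumes c: "reach E c\<^sub>0 c" "c w = 0" "c v \<noteq> 0"
    and d: "reach F (c \<circ> transpose v w) d" "d w \<noteq> 0"
  obtains e where "reach F c e" "e \<cong> d \<circ> transpose v w"
proof -
  let ?t = "transpose v w" and ?P = "\<lambda>c. reach E c\<^sub>0 c \<and> c v = 0 \<and> c w \<noteq> 0"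
  have "reach E c (c \<circ> transpose w v)" using w_v c by (intro reach_step)
  then have ct: "reach E c\<^sub>0 (c \<circ> ?t)"
    using c(1) by (simp add: transpose_commute)
  obtain g where g: "g permutes A" "d = c \<circ> ?t \<circ> g" using d(1) F(2) by (rule reach_permutes)
  have "card (holes d \<inter> A) = card (holes (c \<circ> ?t) \<inter> A)" using d(1) F(2) by (rule reach_card_holes)
  moreover have "holes d \<inter> A = holes d \<inter> (A - {w})"
    "holes (c \<circ> ?t) \<inter> A = holes (c \<circ> ?t) \<inter> (A - {w})"
    using d(2) c(3) by auto
  ultimately have card: "card (holes (c \<circ> ?t) \<inter> (A - {w})) = card (holes d \<inter> (A - {w}))"
    by simp
  \<comment> \<open>Since \<open>w\<close> is occupied before and after, the holes of
    \<open>A\<close> to be matched all lie in \<open>A - {w}\<close>, where \<open>bypass\<close> is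
    connected.\<close>
  have "\<exists>d'. (c \<circ> ?t, d') \<in> parked \<and> ?P d' \<and> holes d' \<inter> (A - {w}) = holes d \<inter> (A - {w}) \<and>
      holes d' - (A - {w}) = holes (c \<circ> ?t) - (A - {w})"
  proof (rule redistribute_holes[where R = bypass and P = ?P])
    show "?P (c \<circ> ?t)" using ct c by simp
  qed (use A(1) bypass_connected refl_parked trans_parked parked_bypass_step card in auto)
  then obtain d' where d': "(c \<circ> ?t, d') \<in> parked" "?P d'"
    "holes d' \<inter> (A - {w}) = holes d \<inter> (A - {w})"
    "holes d' - (A - {w}) = holes (c \<circ> ?t) - (A - {w})" by blast
  have "d' z = 0 \<longleftrightarrow> d z = 0" for z
  proof -
    consider "z = w" | "z \<in> A - {w}" | "z \<notin> A" by blast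
    then show ?thesis
    proof cases
      case 3
      then have "d z = (c \<circ> ?t) z" using g by (simp add: permutes_not_in)
      moreover have "z \<in> holes d' - (A - {w}) \<longleftrightarrow> z \<in> holes (c \<circ> ?t) - (A - {w})"
        by (simp only: d'(4))
      ultimately show ?thesis using 3 by simp
    qed (use d'(2,3) d(2) in blast)+
  qed
  then have "holes d' = holes d" by simp
  obtain e where e: "reach F (c \<circ> ?t) d'" "reach F c e" "e \<circ> ?t \<cong> d'"
    using d'(1) by (auto simp: parked_def comp_assoc)
  have "reach F d' d"
    using reach_sym[OF F(3) e(1)] d(1) by (rule rtrancl_trans)
  then have "d' \<cong> d"
    using rigid_F d'(2) \<open>holes d' = holes d\<close> by (auto intro: rigidD)
  then have "e \<cong> d \<circ> ?t"
    using congruent_trans[OF e(3)] congruent_comp_transpose by blast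
  then show ?thesis using e(2) that by blast
qed

abbreviation "F' \<equiv> F \<union> {(v, w), (w, v)}"

lemma F'_cases:
  assumes "(x, y) \<in> F'"
  obtains "(x, y) \<in> F" "x \<noteq> v" "y \<noteq> v" | "x = v" "y = w" | "x = w" "y = v"
  using assms F(2) leaf by auto

text \<open>Every completed excursion from the leaf is removed by \<open>parking_excursion\<close>.
  At most the last departure from \<open>v\<close> survives; it takes place at \<open>b\<close> and
  is kept only if \<open>v\<close> is empty at the end.\<close>

lemma leaf_walk:
  assumes c: "reach E c\<^sub>0 c" "c v \<noteq> 0" and "reach F' c d"
  shows "if d v \<noteq> 0 then \<exists>e. reach F c e \<and> e \<cong> d
    else \<exists>b e. reach F c b \<and> b w = 0 \<and> b v \<noteq> 0 \<and> reach F (b \<circ> transpose v w) e \<and> e \<cong> d"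
  using assms(3)
proof (induction rule: rtrancl_induct)
  case base
  then show ?case using c congruent_refl by auto
next
  case (step d d')
  obtain x y where xy: "(x, y) \<in> F'" "d x = 0" "d' = d \<circ> transpose x y"
    using step.hyps(2) by (rule hole_stepE)
  show ?case
  proof (cases "d v = 0")
    case False
    then obtain e where e: "reach F c e" "e \<cong> d" using step.IH by auto
    from xy(1) show ?thesis
    proof (cases rule: F'_cases)
      case 1
      have "reach F e (e \<circ> transpose x y)"
        using 1 xy(2) congruent_zero[OF e(2)] by (intro reach_step) auto
      then have "reach F c (e \<circ> transpose x y)" using e(1) by simp
      moreover have "e \<circ> transpose x y \<cong> d'" using e(2) xy(3) congruent_comp by blast
      moreover have "d' v \<noteq> 0" using 1 False xy by simp
      ultimately show ?thesis by auto
    next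
      case 2
      then show ?thesis using xy False by simp
    next
      case 3
      have d': "d' = d \<circ> transpose v w" using xy 3 by (simp add: transpose_commute)
      then have "d' v = 0" using xy 3 by simp
      moreover have "e w = 0" "e v \<noteq> 0" using congruent_zero[OF e(2)] xy 3 False by auto
      moreover have "e \<circ> transpose v w \<cong> d'" using e(2) d' congruent_comp by blast
      ultimately show ?thesis
        using e(1) by (simp only: simp_thms if_False) blast
    qed
  next
    case True
    then obtain b e where b: "reach F c b" "b w = 0" "b v \<noteq> 0"
      "reach F (b \<circ> transpose v w) e" "e \<cong> d"
      using step.IH by auto
    have trivial: "d' = d" if "d w = 0" "{x, y} = {v, w}"
      using that True xy by (auto simp: fun_eq_iff transpose_def doubleton_eq_iff)
    from xy(1) show ?thesis
    proof (cases rule: F'_cases)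
      case 1
      have "reach F e (e \<circ> transpose x y)"
        using 1 xy(2) congruent_zero[OF b(5)] by (intro reach_step) auto
      then have "reach F (b \<circ> transpose v w) (e \<circ> transpose x y)" using b(4) by simp
      moreover have "e \<circ> transpose x y \<cong> d'" using b(5) xy(3) congruent_comp by blast
      moreover have "d' v = 0" using 1 True xy by simp
      ultimately show ?thesis using b(1-3) by auto
    next
      case 2
      show ?thesis
      proof (cases "d w = 0")
        case True
        then have "d' = d" using trivial 2 by simp
        show ?thesis unfolding \<open>d' = d\<close> by (rule step.IH)
      next
        \<comment> \<open>A pebble enters \<open>v\<close> and completes the excursion begun at
          \<open>b\<close>.\<close>
        case False
        then have "e w \<noteq> 0" using congruent_zero[OF b(5)] by auto
        obtain e' where e': "reach F b e'" "e' \<cong> e \<circ> transpose v w"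
          using parking_excursion[OF reach_F_E[OF c(1) b(1)] b(2-4) \<open>e w \<noteq> 0\<close>] .
        have "e' \<cong> d'"
          using congruent_trans[OF e'(2) congruent_comp[OF b(5)]] xy 2 by simp
        moreover have "reach F c e'" using b(1) e'(1) by simp
        moreover have "d' v \<noteq> 0" using xy 2 False by simp
        ultimately show ?thesis by auto
      qed
    next
      case 3
      then have "d' = d" using trivial xy(2) by auto
      show ?thesis unfolding \<open>d' = d\<close> by (rule step.IH)
    qed
  qed
qed

lemma rigid_insert_leaf: "rigid F'"
  unfolding rigid_def
proof (intro allI impI)
  fix c d
  assume c: "reach E c\<^sub>0 c" and d: "reach F' c d" and h: "holes c = holes d"
  have sym_F': "sym F'" using F(3) by (auto simp: sym_def)
  have F'_E: "F' \<subseteq> E" using F(1) leaf(3) w_v by auto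
  have occupied: "c \<cong> d"
    if a: "reach E c\<^sub>0 c" "reach F' c d" "holes c = holes d" "c v \<noteq> 0" for c d
  proof -
    have "d v \<noteq> 0" using a by auto
    then obtain e where e: "reach F c e" "e \<cong> d" using leaf_walk[OF a(1,4,2)] by auto
    then have "c \<cong> e"
      using rigidD[OF rigid_F a(1) e(1)] congruent_holes[OF e(2)] a(3) by simp
    then show ?thesis using e(2) by (rule congruent_trans)
  qed
  show "c \<cong> d"
  proof (cases "\<exists>b. reach F' c b \<and> b v \<noteq> 0")
    case True
    \<comment> \<open>The walk from \<open>c\<close> to \<open>b\<close> is repeated from
      \<open>d\<close>, which has the same holes. The occupied case applies to the two ends, and
      undoing \<open>g\<close> returns to \<open>c\<close> and \<open>d\<close>.\<close>
    then obtain b where b: "reach F' c b" "b v \<noteq> 0" by blast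
    obtain g where g: "g permutes UNIV" "b = c \<circ> g" "reach F' d (d \<circ> g)"
      using b(1) h by (elim reach_permutes[where A = UNIV]) auto
    have "reach F' b (d \<circ> g)"
      using reach_sym[OF sym_F' b(1)] d g(3) by (meson rtrancl_trans)
    moreover have "holes b = holes (d \<circ> g)" using g(2) h by auto
    moreover have "reach E c\<^sub>0 b" using c reach_mono[OF b(1) F'_E] by simp
    ultimately have "b \<cong> d \<circ> g" using b(2) occupied by blast
    then have "b \<circ> inv g \<cong> d \<circ> g \<circ> inv g" by (rule congruent_comp)
    then show ?thesis
      using g(1,2) by (simp add: comp_assoc permutes_inv_o)
  next
    case False
    have "reach F c d" using d
    proof (induction rule: rtrancl_induct)
      case (step d d')
      obtain x y where xy: "(x, y) \<in> F'" "d x = 0" "d' = d \<circ> transpose x y"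
        using step.hyps(2) by (rule hole_stepE)
      have 0: "d v = 0" "d' v = 0"
        using False step.hyps by (auto dest: rtrancl_into_rtrancl)
      from xy(1) show ?case
      proof (cases rule: F'_cases)
        case 1
        then have "reach F d d'" using reach_step[of x y F d] xy by blast
        with step.IH show ?thesis by (rule rtrancl_trans)
      next
        case 2
        then have "d' = d" using xy 0 by (auto simp: fun_eq_iff transpose_def)
        then show ?thesis using step.IH by simp
      next
        case 3
        then have "d' = d" using xy 0 by (auto simp: fun_eq_iff transpose_def)
        then show ?thesis using step.IH by simp
      qed
    qed simp
    then show ?thesis using rigidD[OF rigid_F c] h by blast
  qed
qed

end

end

section \<open>Trees and cycles\<close>

inductive grown_tree :: "'a set \<Rightarrow> 'a rel \<Rightarrow> bool" where
  single: "grown_tree {r} {}"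
| leaf: "grown_tree A F \<Longrightarrow> w \<in> A \<Longrightarrow> v \<notin> A \<Longrightarrow> grown_tree (insert v A) (F \<union> {(v, w), (w, v)})"

lemma grown_tree_basic:
  assumes "grown_tree A F"
  shows "finite A" "F \<subseteq> A \<times> A" "sym F" "irrefl F"
  using assms by (induction) (auto simp: sym_def irrefl_def)

lemma grown_tree_connected:
  assumes "grown_tree A F" "x \<in> A" "y \<in> A"
  shows "(x, y) \<in> F\<^sup>*"
  using assms
proof (induction arbitrary: x y)
  case (leaf A F w v)
  let ?F = "F \<union> {(v, w), (w, v)}"
  have "(x, w) \<in> ?F\<^sup>* \<and> (w, x) \<in> ?F\<^sup>*" if "x \<in> insert v A" for x
  proof (cases "x = v")
    case False
    then have "(x, w) \<in> F\<^sup>*" "(w, x) \<in> F\<^sup>*" using leaf.IH leaf.hyps(2) that by auto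
    moreover have "F\<^sup>* \<subseteq> ?F\<^sup>*" by (rule rtrancl_mono) blast
    ultimately show ?thesis by blast
  qed auto
  then show ?case using leaf.prems by (meson rtrancl_trans)
qed simp

text \<open>The arc is the first one of the path to enter \<open>A\<close>. That the path avoids
  \<open>A\<close> before it later lets a hole travel up to a cycle without disturbing the
  cycle.\<close>

lemma rtrancl_crossing:
  assumes "(x, y) \<in> E\<^sup>*" "x \<notin> A" "y \<in> A"
  obtains u v where "(x, u) \<in> (E \<inter> (-A) \<times> (-A))\<^sup>*" "u \<notin> A" "v \<in> A" "(u, v) \<in> E"
proof -
  have "\<exists>u v. (x, u) \<in> (E \<inter> (-A) \<times> (-A))\<^sup>* \<and> u \<notin> A \<and> v \<in> A \<and> (u, v) \<in> E"
    using assms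
  proof (induction rule: converse_rtrancl_induct)
    case (step x x')
    show ?case
    proof (cases "x' \<in> A")
      case False
      then have "(x, x') \<in> E \<inter> (-A) \<times> (-A)" using step by auto
      then show ?thesis using step False by (meson converse_rtrancl_into_rtrancl)
    qed (use step in blast)
  qed simp
  then show ?thesis using that by blast
qed

lemma grown_spanning_tree:
  assumes "finite V" "V \<noteq> {}" "E \<subseteq> V \<times> V" "sym E" "\<And>x y. x \<in> V \<Longrightarrow> y \<in> V \<Longrightarrow> (x, y) \<in> E\<^sup>*"
  obtains F where "grown_tree V F" "F \<subseteq> E"
proof -
  have "\<exists>F. grown_tree V F \<and> F \<subseteq> E" if "grown_tree A F" "A \<subseteq> V" "F \<subseteq> E" for A F
    using that
  proof (induction "card (V - A)" arbitrary: A F)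
    case 0
    then have "A = V" using assms(1) by auto
    then show ?case using 0 by blast
  next
    case (Suc m)
    then have "V - A \<noteq> {}" by (metis card.empty nat.distinct(1))
    then obtain x where x: "x \<in> V" "x \<notin> A" by blast
    have "A \<noteq> {}" using Suc.prems(1) by cases auto
    then obtain y where y: "y \<in> A" by blast
    have "(x, y) \<in> E\<^sup>*" using x y Suc.prems assms by blast
    then obtain v w where "v \<notin> A" "w \<in> A" "(v, w) \<in> E"
      using x(2) y by (rule rtrancl_crossing)
    moreover have "v \<in> V" "(w, v) \<in> E" using \<open>(v, w) \<in> E\<close> assms by (auto dest: symD)
    moreover have "m = card (V - insert v A)"
    proof -
      have "V - A = insert v (V - insert v A)" using \<open>v \<in> V\<close> \<open>v \<notin> A\<close> by blast
      then have "card (V - A) = Suc (card (V - insert v A))"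
        using assms(1) by (metis card_insert_disjoint finite_Diff DiffD2 insertI1)
      then show ?thesis using Suc.hyps(2) by simp
    qed
    ultimately show ?case
      using Suc.hyps(1)[of "insert v A" "F \<union> {(v, w), (w, v)}"] Suc.prems grown_tree.leaf[of A F w v]
      by blast
  qed
  moreover obtain r where "r \<in> V" using assms(2) by blast
  ultimately show ?thesis using that grown_tree.single[of r] by blast
qed

text \<open>A shortest walk repeats no vertex, since the part between two visits could be cut
  out.\<close>

lemma rtrancl_inj_walk:
  assumes "(a, b) \<in> F\<^sup>*"
  obtains n z where "z 0 = a" "z n = b" "\<And>i. i < n \<Longrightarrow> (z i, z (Suc i)) \<in> F" "inj_on z {..n}"
proof -
  define n where "n = (LEAST n. (a, b) \<in> F ^^ n)"
  have n: "(a, b) \<in> F ^^ n" unfolding n_def using assms by (metis LeastI rtrancl_imp_relpow)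
  then obtain z where z: "z 0 = a" "z n = b" "\<And>i. i < n \<Longrightarrow> (z i, z (Suc i)) \<in> F"
    by (auto simp: relpow_fun_conv)
  have sub: "i + m \<le> n \<Longrightarrow> (z i, z (i + m)) \<in> F ^^ m" for i m
    by (induction m) (auto intro!: relcompI z(3))
  have "z i \<noteq> z j" if "i < j" "j \<le> n" for i j
  proof
    assume "z i = z j"
    have "(a, z i) \<in> F ^^ i" using sub[of 0 i] that z by simp
    moreover have "(z j, b) \<in> F ^^ (n - j)" using sub[of j "n - j"] that z by simp
    ultimately have "(a, b) \<in> F ^^ (i + (n - j))"
      using \<open>z i = z j\<close> by (auto simp: relpow_add)
    then have "n \<le> i + (n - j)" unfolding n_def by (rule Least_le)
    then show False using that by simp
  qed
  then have "inj_on z {..n}" by (auto simp: inj_on_def) (metis linorder_neqE_nat)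
  then show ?thesis using that z by blast
qed

section \<open>Rotations and transpositions along a cycle\<close>

definition cycle_in :: "'a rel \<Rightarrow> (nat \<Rightarrow> 'a) \<Rightarrow> nat \<Rightarrow> bool" where
  "cycle_in E z k \<longleftrightarrow> 3 \<le> k \<and> inj_on z {..<k} \<and> (\<forall>i<k. (z i, z (Suc i mod k)) \<in> E)"

lemma cycle_in_rotate:
  assumes "cycle_in E z k"
  shows "cycle_in E (\<lambda>i. z ((i + s) mod k)) k" "(\<lambda>i. z ((i + s) mod k)) ` {..<k} = z ` {..<k}"
proof -
  have k: "3 \<le> k" and inj: "inj_on z {..<k}" and E: "\<And>i. i < k \<Longrightarrow> (z i, z (Suc i mod k)) \<in> E"
    using assms by (auto simp: cycle_in_def)
  have "inj_on (\<lambda>i. (i + s) mod k) {..<k}"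
  proof (rule linorder_inj_onI)
    fix i j assume *: "i < j" "i \<in> {..<k}" "j \<in> {..<k}"
    then have "\<not> k dvd (j + s) - (i + s)" by (auto dest: dvd_imp_le)
    then show "(i + s) mod k \<noteq> (j + s) mod k"
      using mod_eq_dvd_iff_nat[of "i + s" "j + s" k] * by auto
  qed auto
  moreover have sub: "(\<lambda>i. (i + s) mod k) ` {..<k} \<subseteq> {..<k}" using k by auto
  ultimately have im: "(\<lambda>i. (i + s) mod k) ` {..<k} = {..<k}"
    by (intro endo_inj_surj) auto
  have "inj_on (z \<circ> (\<lambda>i. (i + s) mod k)) {..<k}"
    using \<open>inj_on (\<lambda>i. (i + s) mod k) {..<k}\<close> inj im by (intro comp_inj_on) auto
  moreover have "(z ((i + s) mod k), z ((Suc i mod k + s) mod k)) \<in> E" for i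
    using E[of "(i + s) mod k"] k by (simp add: mod_simps)
  ultimately show "cycle_in E (\<lambda>i. z ((i + s) mod k)) k"
    using k by (simp add: cycle_in_def comp_def)
  show "(\<lambda>i. z ((i + s) mod k)) ` {..<k} = z ` {..<k}"
    using im by (metis image_image)
qed

lemma cycle_in_Suc: "cycle_in E z k \<Longrightarrow> Suc i < k \<Longrightarrow> (z i, z (Suc i)) \<in> E"
  unfolding cycle_in_def by (metis Suc_lessD mod_less)

lemma cycle_in_connected:
  assumes "cycle_in E z k" "sym E" "x \<in> z ` {..<k}" "y \<in> z ` {..<k}"
  shows "(x, y) \<in> (E \<inter> (z ` {..<k}) \<times> (z ` {..<k}))\<^sup>*" (is "_ \<in> ?F\<^sup>*")
proof -
  have "(z 0, z i) \<in> ?F\<^sup>*" if "i < k" for i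
    using that
  proof (induction i)
    case (Suc i)
    then have "(z i, z (Suc i)) \<in> ?F" using cycle_in_Suc[OF assms(1)] by auto
    then show ?case using Suc by (simp add: rtrancl.rtrancl_into_rtrancl)
  qed simp
  moreover have "sym (?F\<^sup>*)" using assms(2) by (intro sym_rtrancl) (auto simp: sym_def)
  ultimately show ?thesis
    using assms(3,4) by (auto dest: symD intro: rtrancl_trans)
qed

text \<open>As a permutation of positions this describes a hole running from \<open>z 0\<close> to
  \<open>z m\<close>: each content on its way moves back by one vertex.\<close>

primrec hole_path :: "(nat \<Rightarrow> 'a) \<Rightarrow> nat \<Rightarrow> 'a \<Rightarrow> 'a" where
  "hole_path z 0 = id"
| "hole_path z (Suc m) = hole_path z m \<circ> transpose (z m) (z (Suc m))"

lemma hole_path_apply: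
  assumes "inj_on z {..m}"
  shows "(\<forall>i<m. hole_path z m (z i) = z (Suc i)) \<and> hole_path z m (z m) = z 0 \<and>
    (\<forall>x. x \<notin> z ` {..m} \<longrightarrow> hole_path z m x = x)"
  using assms
proof (induction m)
  case (Suc m)
  have "inj_on z {..m}" using Suc.prems by (rule inj_on_subset) auto
  then have IH: "\<And>i. i < m \<Longrightarrow> hole_path z m (z i) = z (Suc i)" "hole_path z m (z m) = z 0"
    "\<And>x. x \<notin> z ` {..m} \<Longrightarrow> hole_path z m x = x"
    using Suc.IH by auto
  have new: "z (Suc m) \<notin> z ` {..m}"
    using inj_onD[OF Suc.prems] by fastforce
  have "hole_path z (Suc m) (z i) = z (Suc i)" if "i < Suc m" for i
  proof (cases "i = m")
    case True
    then show ?thesis using IH(3)[OF new] by simp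
  next
    case False
    then have "z i \<noteq> z m" "z i \<noteq> z (Suc m)"
      using that Suc.prems by (auto simp: inj_on_def)
    then show ?thesis using IH(1) that False by simp
  qed
  moreover have "hole_path z (Suc m) x = x" if "x \<notin> z ` {..Suc m}" for x
  proof -
    have "x \<noteq> z m" "x \<noteq> z (Suc m)" "x \<notin> z ` {..m}" using that by auto
    then show ?thesis using IH(3) by simp
  qed
  ultimately show ?case using IH(2) by simp
qed simp

lemma reach_hole_path:
  assumes "\<And>i. i < m \<Longrightarrow> (z i, z (Suc i)) \<in> E" "inj_on z {..m}" "c (z 0) = 0"
  shows "reach E c (c \<circ> hole_path z m)"
  using assms(1,2)
proof (induction m)
  case (Suc m)
  have inj: "inj_on z {..m}" using Suc.prems(2) by (rule inj_on_subset) auto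
  have "reach E (c \<circ> hole_path z m) (c \<circ> hole_path z m \<circ> transpose (z m) (z (Suc m)))"
    using Suc.prems(1) hole_path_apply[OF inj] assms(3) by (intro reach_step) auto
  moreover have "reach E c (c \<circ> hole_path z m)" using Suc.prems(1) inj by (intro Suc.IH) auto
  ultimately have "reach E c (c \<circ> hole_path z m \<circ> transpose (z m) (z (Suc m)))"
    by (metis rtrancl_trans)
  then show ?case by (simp only: hole_path.simps comp_assoc)
qed simp

text \<open>The hole \<open>w\<close> hangs at \<open>z 1\<close>, so the star with centre
  \<open>z 1\<close> and ends \<open>w\<close>, \<open>z 0\<close>, \<open>z 2\<close> allows the
  contents of \<open>z 1\<close> and \<open>z 2\<close> to be exchanged.\<close>

lemma reach_cycle_transpose:
  assumes cyc: "cycle_in E z k" and "sym E"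
    and w: "w \<notin> z ` {..<k}" "(z 1, w) \<in> E"
    and c: "c w = 0" "c (z 0) = 0"
    and ij: "x \<in> z ` {..<k}" "y \<in> z ` {..<k}" "c x \<noteq> 0" "c y \<noteq> 0"
  shows "reach E c (c \<circ> transpose x y)"
proof -
  have k: "3 \<le> k" and inj: "inj_on z {..<k}" and E: "\<And>i. i < k \<Longrightarrow> (z i, z (Suc i mod k)) \<in> E"
    using cyc by (auto simp: cycle_in_def)
  have z_eq: "z i = z j \<longleftrightarrow> i = j" if "i < k" "j < k" for i j
    using inj that by (auto simp: inj_on_def)
  have wz: "w \<noteq> z i" if "i < k" for i using w(1) that by auto
  \<comment> \<open>The realizable permutations of positions that fix the holes \<open>w\<close> and \<open>z 0\<close> form a group;
    conjugating one adjacent transposition by the rotation \<open>\<rho>\<close> yields all of them.\<close>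
  define ok :: "('a \<Rightarrow> 'a) \<Rightarrow> bool" where
    "ok g \<longleftrightarrow> g w = w \<and> g (z 0) = z 0 \<and>
      (\<forall>c :: 'a \<Rightarrow> 'b. c w = 0 \<longrightarrow> c (z 0) = 0 \<longrightarrow> reach E c (c \<circ> g))" for g
  have ok_comp: "ok (g \<circ> h)" if "ok g" "ok h" for g h
    unfolding ok_def
  proof (intro conjI allI impI)
    fix c :: "'a \<Rightarrow> 'b" assume *: "c w = 0" "c (z 0) = 0"
    then have "reach E c (c \<circ> g)" "reach E (c \<circ> g) (c \<circ> g \<circ> h)"
      using that by (auto simp: ok_def)
    then show "reach E c (c \<circ> (g \<circ> h))" by (metis rtrancl_trans comp_assoc)
  qed (use that in \<open>auto simp: ok_def\<close>)
  have ok_inv: "ok (inv g)" if "ok g" "bij g" for g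
    unfolding ok_def
  proof (intro conjI allI impI)
    show *: "inv g w = w" "inv g (z 0) = z 0"
      using that by (auto simp: ok_def bij_def inv_f_eq)
    fix c :: "'a \<Rightarrow> 'b" assume "c w = 0" "c (z 0) = 0"
    then have "reach E (c \<circ> inv g) (c \<circ> inv g \<circ> g)" using that(1) * by (auto simp: ok_def)
    then show "reach E c (c \<circ> inv g)"
      using that(2) reach_sym[OF \<open>sym E\<close>] by (simp add: comp_assoc bij_def)
  qed
  \<comment> \<open>The hole runs once around the cycle. The closing step returns it to
    \<open>z 0\<close>; the other contents have moved by one place, that of \<open>z 1\<close> to
    \<open>z (k - 1)\<close>.\<close>
  define \<rho> where "\<rho> = hole_path z (k - 1) \<circ> transpose (z (k - 1)) (z 0)"
  have injk: "inj_on z {..k - 1}" using inj k by (rule_tac inj_on_subset) auto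
  note hp = hole_path_apply[OF injk]
  have \<rho>: "\<rho> (z i) = z (Suc i)" if "0 < i" "Suc i < k" for i
    using hp that k by (simp add: \<rho>_def z_eq)
  have \<rho>0: "\<rho> (z 0) = z 0" using hp by (simp add: \<rho>_def)
  have \<rho>w: "\<rho> w = w"
  proof -
    have "w \<notin> z ` {..k - 1}" using w(1) k by auto
    then show ?thesis using hp wz k by (simp add: \<rho>_def)
  qed
  have bij_path: "bij (hole_path z m)" for m
  proof (induction m)
    case (Suc m)
    then show ?case unfolding hole_path.simps by (intro bij_comp) auto
  qed (simp only: hole_path.simps bij_id)
  then have "bij \<rho>" unfolding \<rho>_def by (intro bij_comp) auto
  have "ok \<rho>"
    unfolding ok_def
  proof (intro conjI allI impI \<rho>0 \<rho>w)
    fix c :: "'a \<Rightarrow> 'b" assume "c w = 0" "c (z 0) = 0"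
    then have "reach E c (c \<circ> hole_path z (k - 1))"
      using cycle_in_Suc[OF cyc] injk by (intro reach_hole_path) auto
    moreover have "reach E (c \<circ> hole_path z (k - 1)) (c \<circ> hole_path z (k - 1) \<circ> transpose (z (k - 1)) (z 0))"
      using E[of "k - 1"] k hp \<open>c (z 0) = 0\<close> by (intro reach_step) auto
    ultimately show "reach E c (c \<circ> \<rho>)" unfolding \<rho>_def by (metis rtrancl_trans comp_assoc)
  qed
  have adj: "ok (transpose (z i) (z (Suc i)))" if "0 < i" "Suc i < k" for i
    using that
  proof (induction i rule: nat_induct_non_zero)
    case 1
    have "(z 1, z 0) \<in> E" "(z 1, z 2) \<in> E"
      using cycle_in_Suc[OF cyc, of 0] cycle_in_Suc[OF cyc, of 1] \<open>sym E\<close> k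
      by (auto dest: symD simp: numeral_2_eq_2)
    then have "reach E c (c \<circ> transpose (z 1) (z 2))" if "c w = 0" "c (z 0) = 0" for c :: "'a \<Rightarrow> 'b"
      using k wz[of 0] wz[of 1] wz[of 2] that w(2) by (intro reach_star_swap[OF \<open>sym E\<close>, of "z 1" w "z 0"]) (auto simp: z_eq)
    then show ?case
      using k wz[of 1] wz[of 2] by (auto simp: ok_def z_eq numeral_2_eq_2)
  next
    case (Suc i)
    have "transpose (z (Suc i)) (z (Suc (Suc i))) = \<rho> \<circ> transpose (z i) (z (Suc i)) \<circ> inv \<rho>"
    proof -
      have "\<rho> \<circ> transpose (z i) (z (Suc i)) = transpose (z (Suc i)) (z (Suc (Suc i))) \<circ> \<rho>"
        using Suc.hyps Suc.prems \<rho>[of i] \<rho>[of "Suc i"] bij_is_inj[OF \<open>bij \<rho>\<close>]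
        by (auto simp: fun_eq_iff transpose_def inj_eq) (metis injD)+
      moreover have "\<rho> \<circ> inv \<rho> = id" using \<open>bij \<rho>\<close> by (simp add: bij_is_surj surj_iff[symmetric])
      ultimately show ?thesis by (simp add: comp_assoc)
    qed
    moreover have "ok (transpose (z i) (z (Suc i)))" using Suc by simp
    ultimately show ?case
      using ok_comp ok_inv[OF \<open>ok \<rho>\<close> \<open>bij \<rho>\<close>] \<open>ok \<rho>\<close> by metis
  qed
  have all: "ok (transpose (z i) (z (i + Suc m)))" if "0 < i" "i + Suc m < k" for i m
    using that
  proof (induction m)
    case 0
    then show ?case using adj[of i] by simp
  next
    case (Suc m)
    let ?j = "i + Suc m"
    have "transpose (z i) (z (Suc ?j)) =
        transpose (z ?j) (z (Suc ?j)) \<circ> transpose (z i) (z ?j) \<circ> transpose (z ?j) (z (Suc ?j))"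
      using Suc.prems z_eq[of i ?j] z_eq[of i "Suc ?j"] z_eq[of ?j "Suc ?j"]
      by (auto simp: fun_eq_iff transpose_def)
    moreover have "ok (transpose (z i) (z ?j))" "ok (transpose (z ?j) (z (Suc ?j)))"
      using adj[of ?j] Suc by simp_all
    ultimately show ?case using ok_comp by (metis add_Suc_right)
  qed
  have less: "ok (transpose (z i) (z j))" if "0 < i" "i < j" "j < k" for i j
    using all[of i "j - Suc i"] that by simp
  obtain i j where xy: "x = z i" "y = z j" "i < k" "j < k" using ij(1,2) by blast
  have "0 < i" "0 < j" using c(2) ij(3,4) xy by (metis gr0I)+
  then consider "x = y" | "ok (transpose x y)"
    using less[of i j] less[of j i] xy by (metis linorder_neqE_nat transpose_commute)
  then show ?thesis using c by cases (auto simp: ok_def)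
qed

section \<open>Rigidity of graphs without Hamiltonian cycle\<close>

context pebbling
begin

lemma rigid_tree: "grown_tree A F \<Longrightarrow> F \<subseteq> E \<Longrightarrow> rigid F"
proof (induction rule: grown_tree.induct)
  case (single r)
  show ?case by (simp add: rigid_def hole_step_def congruent_refl)
next
  case (leaf A F w v)
  note basic = grown_tree_basic[OF leaf.hyps(1)]
  show ?case
  proof (rule rigid_insert_leaf)
    show "(x, y) \<in> F\<^sup>*" if "x \<in> A" "y \<in> A" for x y
      using leaf.hyps(1) that by (rule grown_tree_connected)
  qed (use leaf basic in auto)
qed

text \<open>Three things are arranged without losing \<open>c x\<close> and \<open>c y\<close> from
  the cycle: a hole \<open>w\<close> off the cycle, its neighbour \<open>q\<close> numbered
  \<open>1\<close>, and a hole at the vertex numbered \<open>0\<close>. Then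
  \<open>reach_cycle_transpose\<close> applies.\<close>

lemma cycle_swappable:
  assumes V: "E \<subseteq> V \<times> V" "\<And>x y. x \<in> V \<Longrightarrow> y \<in> V \<Longrightarrow> (x, y) \<in> E\<^sup>*"
    and cyc: "cycle_in E z k" "z ` {..<k} \<noteq> V"
    and c: "reach E c\<^sub>0 c" "a \<in> z ` {..<k}" "c a = 0" "u \<in> V" "u \<noteq> a" "c u = 0"
    and xy: "x \<in> z ` {..<k}" "y \<in> z ` {..<k}" "c x \<noteq> 0" "c y \<noteq> 0"
  shows "c x \<approx> c y"
proof -
  define Z where "Z = z ` {..<k}"
  have k: "3 \<le> k" using cyc by (simp add: cycle_in_def)
  have Z_V: "Z \<subseteq> V"
    using cyc(1) V(1) by (fastforce simp: Z_def cycle_in_def)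
  have "a \<in> Z" using c by (simp add: Z_def)
  \<comment> \<open>Sliding a hole within the cycle shifts pebbles about, so only the set of labels
    on \<open>Z\<close> is recorded.\<close>
  have shift: "\<exists>c'. reach E c c' \<and> c' y = 0 \<and> (\<forall>v. c v = 0 \<longrightarrow> v \<noteq> x \<longrightarrow> c' v = 0) \<and>
      c' ` Z = c ` Z \<and> (\<forall>v. v \<notin> Z \<longrightarrow> c' v = c v)"
    if "x \<in> Z" "y \<in> Z" "c x = 0" for x y and c :: "'a \<Rightarrow> 'b"
  proof (cases "c y = 0")
    case True
    then show ?thesis by (intro exI[of _ c]) auto
  next
    case False
    have "(x, y) \<in> (E \<inter> Z \<times> Z)\<^sup>*"
      using cycle_in_connected[OF cyc(1) sym_E] that by (simp add: Z_def)
    then obtain d where d: "reach (E \<inter> Z \<times> Z) c d" "holes d = insert y (holes c - {x})"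
      using \<open>c x = 0\<close> False by (rule reach_transport_hole)
    obtain g where g: "g permutes Z" "d = c \<circ> g"
      using d(1) by (elim reach_permutes[where A = Z]) auto
    have "d ` Z = c ` Z" using permutes_image[OF g(1)] g(2) by (metis image_comp)
    moreover have "d v = c v" if "v \<notin> Z" for v using g that by (simp add: permutes_not_in)
    moreover have "reach E c d" using d(1) by (rule reach_mono) auto
    ultimately show ?thesis using d(2) by blast
  qed
  have "\<exists>w q c1. w \<notin> Z \<and> q \<in> Z \<and> (w, q) \<in> E \<and> reach E c c1 \<and> c1 w = 0 \<and> (\<exists>b\<in>Z. c1 b = 0) \<and>
      c ` Z \<subseteq> c1 ` Z"
  proof (cases "u \<in> Z")
    case False
    \<comment> \<open>The second hole lies off the cycle and is carried, outside \<open>Z\<close>,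
      to a vertex adjacent to \<open>Z\<close>.\<close>
    have "(u, a) \<in> E\<^sup>*" using V(2) c(4) Z_V \<open>a \<in> Z\<close> by blast
    then obtain w q where w: "(u, w) \<in> (E \<inter> (-Z) \<times> (-Z))\<^sup>*" "w \<notin> Z" "q \<in> Z" "(w, q) \<in> E"
      using False \<open>a \<in> Z\<close> by (rule rtrancl_crossing)
    show ?thesis
    proof (cases "c w = 0")
      case True
      then show ?thesis using w \<open>a \<in> Z\<close> c(3) by blast
    next
      case False
      obtain d where d: "reach (E \<inter> (-Z) \<times> (-Z)) c d" "holes d = insert w (holes c - {u})"
        using w(1) c(6) False by (rule reach_transport_hole)
      obtain g where g: "g permutes -Z" "d = c \<circ> g"
        using d(1) by (elim reach_permutes[where A = "-Z"]) auto
      have same: "d v = c v" if "v \<in> Z" for v using g that by (simp add: permutes_not_in)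
      then have "d ` Z = c ` Z" by simp
      moreover have "reach E c d" using d(1) by (rule reach_mono) auto
      moreover have "d w = 0" using d(2) by blast
      moreover have "d a = 0" using same \<open>a \<in> Z\<close> c(3) by simp
      ultimately show ?thesis using w \<open>a \<in> Z\<close> by blast
    qed
  next
    case True
    \<comment> \<open>Both holes lie on the cycle, which misses some vertex. One is brought to the
      end \<open>q\<close> of an edge leaving the cycle and exchanged with \<open>w\<close>; the
      cycle loses no label, since \<open>b\<close> still carries \<open>0\<close>.\<close>
    obtain v where v: "v \<in> V" "v \<notin> Z" using Z_V cyc(2) by (auto simp: Z_def)
    have "(v, a) \<in> E\<^sup>*" using V(2) v Z_V \<open>a \<in> Z\<close> by blast
    then obtain w q where w: "w \<notin> Z" "q \<in> Z" "(w, q) \<in> E"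
      using v(2) \<open>a \<in> Z\<close> by (rule rtrancl_crossing)
    have "\<exists>c' b. reach E c c' \<and> c' q = 0 \<and> b \<in> Z \<and> b \<noteq> q \<and> c' b = 0 \<and> c' ` Z = c ` Z"
    proof (cases "u = q")
      case True
      then show ?thesis using c \<open>a \<in> Z\<close> by blast
    next
      case False
      then show ?thesis using shift[of a q c] \<open>a \<in> Z\<close> w(2) c(3) \<open>u \<in> Z\<close> c(5,6) by blast
    qed
    then obtain c' b where c': "reach E c c'" "c' q = 0" "b \<in> Z" "b \<noteq> q" "c' b = 0" "c' ` Z = c ` Z"
      by blast
    define c1 where "c1 = c' \<circ> transpose q w"
    have "(q, w) \<in> E" using w(3) sym_E by (rule symD[rotated])
    then have "reach E c' c1" unfolding c1_def using c'(2) by (rule reach_step)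
    then have "reach E c c1" using c'(1) by simp
    moreover have "c1 w = 0" using c'(2) by (simp add: c1_def)
    moreover have c1b: "c1 b = 0" using c' w by (auto simp: c1_def transpose_def)
    moreover have "c' ` Z \<subseteq> c1 ` Z"
    proof (rule image_subsetI)
      fix v assume v: "v \<in> Z"
      show "c' v \<in> c1 ` Z"
      proof (cases "v = q")
        case True
        then show ?thesis using c1b c'(2,3) by (metis imageI)
      next
        case False
        then have "c1 v = c' v" using v w by (auto simp: c1_def transpose_def)
        then show ?thesis using v by (metis imageI)
      qed
    qed
    ultimately show ?thesis
      using w c'(3) by (intro exI[of _ w] exI[of _ q] exI[of _ c1] conjI bexI[of _ b]) (auto simp: c'(6))
  qed
  then obtain w q c1 b where c1: "w \<notin> Z" "q \<in> Z" "(w, q) \<in> E" "reach E c c1" "c1 w = 0"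
    "b \<in> Z" "c1 b = 0" "c ` Z \<subseteq> c1 ` Z" by blast
  obtain i where i: "i < k" "q = z i" using c1(2) by (auto simp: Z_def)
  \<comment> \<open>Modulo \<open>k\<close>, the shift \<open>i + k - 1\<close> is
    \<open>i - 1\<close> kept nonnegative, so that \<open>q\<close> receives number
    \<open>1\<close>.\<close>
  define z' where "z' = (\<lambda>j. z ((j + (i + k - 1)) mod k))"
  have z': "cycle_in E z' k" "z' ` {..<k} = Z"
    using cycle_in_rotate[OF cyc(1), of "i + k - 1"] by (simp_all add: z'_def Z_def)
  have "z' 1 = q" using i k by (simp add: z'_def)
  have "z' 0 \<in> Z" using z'(2) k by auto
  then obtain c2 where c2: "reach E c1 c2" "c2 (z' 0) = 0"
    "c2 ` Z = c1 ` Z" "c2 w = 0" using shift[of b "z' 0" c1] c1(1,5-7) by metis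
  have "c x \<in> c2 ` Z" "c y \<in> c2 ` Z" using c1(8) c2(3) xy by (auto simp: Z_def)
  then obtain x' y' where x': "x' \<in> Z" "y' \<in> Z" "c x = c2 x'" "c y = c2 y'" by auto
  have "reach E c2 (c2 \<circ> transpose x' y')"
  proof (rule reach_cycle_transpose[OF z'(1) sym_E])
    show "(z' 1, w) \<in> E" using c1(3) sym_E \<open>z' 1 = q\<close> by (auto dest: symD)
  qed (use c1(1) c2 x' xy z'(2) in auto)
  moreover have "reach E c\<^sub>0 c2" using c(1) c1(4) c2(1) by simp
  ultimately show ?thesis
    using swappable_if_reach_transpose[of c2 x' y'] x' xy by simp
qed

lemma rigid_graph:
  assumes V: "finite V" "E \<subseteq> V \<times> V" "\<And>x y. x \<in> V \<Longrightarrow> y \<in> V \<Longrightarrow> (x, y) \<in> E\<^sup>*"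
    and cyc: "\<And>z k. cycle_in E z k \<Longrightarrow> z ` {..<k} \<noteq> V"
    and two: "2 \<le> card (holes c\<^sub>0 \<inter> V)"
  shows "rigid E"
proof -
  have "V \<noteq> {}" using two by auto
  then obtain F where F: "grown_tree V F" "F \<subseteq> E"
    using grown_spanning_tree[OF V(1) _ V(2) sym_E V(3)] by blast
  have rigid_F: "rigid F" using F by (rule rigid_tree)
  \<comment> \<open>One step along an arbitrary edge is imitated within the tree, up to
    interchangeable labels.\<close>
  have edge: "\<exists>d. reach F c d \<and> d \<cong> c \<circ> transpose a b"
    if c: "reach E c\<^sub>0 c" and ab: "(a, b) \<in> E" and a: "c a = 0" for a b c
  proof (cases "c b = 0 \<or> (a, b) \<in> F")
    case True
    then consider "c \<circ> transpose a b = c" | "(a, b) \<in> F"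
      using a by (auto simp: fun_eq_iff transpose_def)
    then show ?thesis
          proof cases
      case 1
      then show ?thesis using congruent_refl[of c] by (intro exI[of _ c]) simp
    next
      case 2
      then show ?thesis using reach_step[of a b F c] a congruent_refl by blast
    qed
  next
    case False
    have ab_V: "a \<in> V" "b \<in> V" using ab V(2) by auto
    then have "(a, b) \<in> F\<^sup>*" using grown_tree_connected[OF F(1)] by blast
    then obtain n z where z: "z 0 = a" "z n = b" "\<And>i. i < n \<Longrightarrow> (z i, z (Suc i)) \<in> F"
      and inj: "inj_on z {..n}" by (rule rtrancl_inj_walk) blast
    \<comment> \<open>Of \<open>a\<close> and \<open>b\<close> only \<open>a\<close> is a hole, and
      the edge is not in the tree. Hence the tree path has length at least two, and the edge closes
      it to a cycle.\<close>
    have "n \<noteq> 0" using z a False by (metis (full_types))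
    moreover have "n \<noteq> 1" using z(1,2) z(3)[of 0] False by auto
    ultimately have n: "2 \<le> n" by simp
    define Z where "Z = z ` {..<Suc n}"
    have Z: "a \<in> Z" "b \<in> Z" using z(1,2) by (auto simp: Z_def)
    have cycle: "cycle_in E z (Suc n)"
      unfolding cycle_in_def
    proof (intro conjI allI impI)
      fix i assume "i < Suc n"
      then consider "i < n" | "i = n" by linarith
      then show "(z i, z (Suc i mod Suc n)) \<in> E"
      proof cases
        case 1
        then show ?thesis using z(3)[of i] F(2) by auto
      next
        case 2
        then show ?thesis using z(1,2) ab sym_E by (auto dest: symD)
      qed
    qed (use n inj in \<open>auto simp: lessThan_Suc_atMost\<close>)
    have "(z 0, z i) \<in> (F \<inter> Z \<times> Z)\<^sup>*" if "i \<le> n" for i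
      using that
    proof (induction i)
      case (Suc i)
      then have "(z i, z (Suc i)) \<in> F \<inter> Z \<times> Z" using z(3)[of i] by (auto simp: Z_def)
      then show ?case using Suc by (simp add: rtrancl.rtrancl_into_rtrancl)
    qed simp
    then have "(a, b) \<in> (F \<inter> Z \<times> Z)\<^sup>*" using z(1,2) by auto
    moreover have "c b \<noteq> 0" using False by simp
    ultimately obtain d where d: "reach (F \<inter> Z \<times> Z) c d" "holes d = insert b (holes c - {a})"
      using a reach_transport_hole by metis
    obtain g where g: "g permutes Z" "d = c \<circ> g"
      using d(1) by (elim reach_permutes[where A = Z]) auto
    \<comment> \<open>The number of holes in \<open>V\<close> never changes, so a second hole
      besides \<open>a\<close> is available.\<close>
    have "card (holes c \<inter> V) \<ge> 2" using reach_card_holes[OF c V(2)] two by simp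
    then have "\<not> holes c \<inter> V \<subseteq> {a}" using card_mono[of "{a}" "holes c \<inter> V"] by auto
    then obtain u where u: "u \<in> V" "u \<noteq> a" "c u = 0" by blast
    \<comment> \<open>Both sides have the same holes and only permute the contents of
      \<open>Z\<close>, where any two pebbles are interchangeable.\<close>
    have "d v \<approx> (c \<circ> transpose a b) v" for v
    proof (cases "v \<in> Z \<and> d v \<noteq> 0")
      case True
      have "holes d = holes (c \<circ> transpose a b)"
        using d(2) holes_comp_transpose[of c a b] a \<open>c b \<noteq> 0\<close> by simp
      then have nz: "c (transpose a b v) \<noteq> 0" using True by auto
      have "g v \<in> Z" using True permutes_in_image[OF g(1)] by simp
      moreover have "transpose a b v \<in> Z" using True Z by (auto simp: transpose_def)
      moreover have "c (g v) \<noteq> 0" using True g(2) by simp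
      ultimately have "c (g v) \<approx> c (transpose a b v)"
        using cycle_swappable[OF V(2,3) cycle cyc[OF cycle] c _ a u] Z nz
        unfolding Z_def by blast
      then show ?thesis using g(2) by simp
    next
      case False
      have "d v = (c \<circ> transpose a b) v"
      proof (cases "v \<in> Z")
        case True
        then have "v \<in> holes d" using False by simp
        then have "v \<in> holes (c \<circ> transpose a b)"
          using d(2) holes_comp_transpose[of c a b] a \<open>c b \<noteq> 0\<close> by blast
        then show ?thesis using True False by simp
      next
        case False
        then have "v \<noteq> a" "v \<noteq> b" using Z by auto
        then show ?thesis using g False by (simp add: permutes_not_in)
      qed
      then show ?thesis by (simp add: swappable_def)
    qed
    then have "d \<cong> c \<circ> transpose a b" by (simp add: congruent_mod_def)
    moreover have "reach F c d" using d(1) by (rule reach_mono) auto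
    ultimately show ?thesis by blast
  qed
  have walk: "\<exists>e. reach F c e \<and> e \<cong> d" if c: "reach E c\<^sub>0 c" and d: "reach E c d" for c d
    using d
  proof (induction rule: rtrancl_induct)
    case base
    then show ?case using congruent_refl by blast
  next
    case (step d d')
    then obtain e where e: "reach F c e" "e \<cong> d" by blast
    obtain x y where xy: "(x, y) \<in> E" "d x = 0" "d' = d \<circ> transpose x y"
      using step.hyps(2) by (rule hole_stepE)
    have "reach E c\<^sub>0 e" using c reach_mono[OF e(1) F(2)] by simp
    then obtain e' where e': "reach F e e'" "e' \<cong> e \<circ> transpose x y"
      using edge xy(1,2) congruent_zero[OF e(2)] by blast
    have "e' \<cong> d'" using e'(2) congruent_comp[OF e(2)] xy(3) congruent_trans by blast
    then show ?case using e(1) e'(1) by (meson rtrancl_trans)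
  qed
  show ?thesis
    unfolding rigid_def
  proof (intro allI impI)
    fix c d assume c: "reach E c\<^sub>0 c" and d: "reach E c d" and h: "holes c = holes d"
    obtain e where e: "reach F c e" "e \<cong> d" using walk[OF c d] by blast
    have "c \<cong> e" using rigidD[OF rigid_F c e(1)] congruent_holes[OF e(2)] h by simp
    then show "c \<cong> d" using e(2) by (rule congruent_trans)
  qed
qed

end

section \<open>Configurations on undirected graphs\<close>

lemma rtrancl_on_iff:
  assumes "E \<subseteq> V \<times> V" "u \<in> V"
  shows "(u, v) \<in> rtrancl_on V E \<longleftrightarrow> (u, v) \<in> E\<^sup>*"
proof
  assume "(u, v) \<in> rtrancl_on V E"
  then show "(u, v) \<in> E\<^sup>*" by (rule rtrancl_on_rtranclI)
next
  assume "(u, v) \<in> E\<^sup>*"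
  then show "(u, v) \<in> rtrancl_on V E"
  proof (induction rule: rtrancl_induct)
    case (step y z)
    then show ?case using assms(1) by (auto intro: rtrancl_on_into_rtrancl_on)
  qed (use assms in simp)
qed

lemma connected_with_proj_iff:
  assumes "parcs G \<subseteq> pverts G \<times> pverts G" "sym (parcs G)"
  shows "Digraph_Component.connected (with_proj G) \<longleftrightarrow>
    pverts G \<noteq> {} \<and> (\<forall>u\<in>pverts G. \<forall>v\<in>pverts G. (u, v) \<in> (parcs G)\<^sup>*)"
proof -
  have "(arcs_ends (with_proj G))\<^sup>s = parcs G"
    using assms(2) by (auto simp: symcl_def sym_def arcs_ends_conv)
  then show ?thesis
    using assms(1) by (simp add: connected_conv rtrancl_on_iff)
qed

lemma pair_graph_arcs:
  assumes "pair_graph G"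
  shows "finite (pverts G)" "parcs G \<subseteq> pverts G \<times> pverts G" "sym (parcs G)"
proof -
  interpret pair_graph G by fact
  show "finite (pverts G)" by simp
  show "parcs G \<subseteq> pverts G \<times> pverts G" using in_arcsD1 in_arcsD2 by auto
  show "sym (parcs G)" using sym_arcs by (simp add: symmetric_def arcs_ends_conv)
qed

text \<open>A cycle without one of its edges is a path through the same vertices, so deleting any
  edge leaves a Hamiltonian path.\<close>

lemma hamiltonian_imp_two_edge_connected:
  assumes G: "pair_graph G" and cyc: "cycle_in (parcs G) z k" "z ` {..<k} = pverts G"
  shows "two_edge_connected G"
proof -
  note arcs = pair_graph_arcs[OF G]
  have k: "3 \<le> k" and inj: "inj_on z {..<k}" using cyc by (auto simp: cycle_in_def)
  have "z 0 \<in> z ` {..<k}" using k by simp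
  then have ne: "pverts G \<noteq> {}" using cyc(2) by blast
  have card: "card (pverts G) = k" using card_image[OF inj] cyc(2) by simp
  have conn: "(x, y) \<in> (parcs G)\<^sup>*" if "x \<in> pverts G" "y \<in> pverts G" for x y
    using cycle_in_connected[OF cyc(1) arcs(3)] that cyc(2)
    by (metis Int_lower1 rtrancl_mono subsetD)
  have "Digraph_Component.connected (with_proj (delete_edge G u v))" for u v
  proof -
    define E where "E = parcs G - {(u, v), (v, u)}"
    have E: "sym E" "E \<subseteq> pverts G \<times> pverts G" using arcs by (auto simp: E_def sym_def)
    have "\<exists>z'. cycle_in (parcs G) z' k \<and> z' ` {..<k} = pverts G \<and>
        (\<forall>i. Suc i < k \<longrightarrow> (z' i, z' (Suc i)) \<in> E)"
    proof (cases "\<exists>i<k. {z i, z (Suc i mod k)} = {u, v}")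
      case True
      then obtain i where i: "i < k" "{z i, z (Suc i mod k)} = {u, v}" by blast
      \<comment> \<open>The cycle is renumbered so that the deleted edge is the closing one, from
        \<open>z' (k - 1)\<close> to \<open>z' 0\<close>.\<close>
      define z' where "z' = (\<lambda>j. z ((j + Suc i) mod k))"
      have z': "cycle_in (parcs G) z' k" "z' ` {..<k} = pverts G"
        using cycle_in_rotate[OF cyc(1), of "Suc i"] cyc(2) by (simp_all add: z'_def)
      have "z' (k - 1) = z i" using i(1) k by (simp add: z'_def)
      moreover have "z' 0 = z (Suc i mod k)" by (simp add: z'_def)
      ultimately have uv: "{z' (k - 1), z' 0} = {u, v}" using i(2) by simp
      have eq: "z' a = z' b \<longleftrightarrow> a = b" if "a < k" "b < k" for a b
        using z'(1) that by (auto simp: cycle_in_def inj_on_def)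
      have "(z' j, z' (Suc j)) \<in> E" if "Suc j < k" for j
      proof -
        \<comment> \<open>The closing edge could reappear only for \<open>j = 0\<close> and
          \<open>k = 2\<close>, which \<open>3 \<le> k\<close> excludes.\<close>
        have "{z' j, z' (Suc j)} \<noteq> {z' (k - 1), z' 0}"
        proof -
          have "z' j \<noteq> z' (k - 1)" using eq[of j "k - 1"] that k by simp
          moreover have "z' j \<noteq> z' 0 \<or> z' (Suc j) \<noteq> z' (k - 1)"
            using eq[of j 0] eq[of "Suc j" "k - 1"] that k by (cases "j = 0") auto
          ultimately show ?thesis by (metis doubleton_eq_iff)
        qed
        then show ?thesis
          using cycle_in_Suc[OF z'(1) that] unfolding uv E_def by blast
      qed
      then show ?thesis using z' by blast
    next
      case False
      have "(z i, z (Suc i)) \<in> E" if "Suc i < k" for i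
      proof -
        have "{z i, z (Suc i)} \<noteq> {u, v}" using False that by (metis Suc_lessD mod_less)
        then show ?thesis using cycle_in_Suc[OF cyc(1) that] unfolding E_def by blast
      qed
      then show ?thesis using cyc by blast
    qed
    then obtain z' where z': "z' ` {..<k} = pverts G" "\<And>i. Suc i < k \<Longrightarrow> (z' i, z' (Suc i)) \<in> E"
      by blast
    have "(z' 0, z' i) \<in> E\<^sup>*" if "i < k" for i
      using that
    proof (induction i)
      case (Suc i)
      then show ?case using z'(2)[of i] by (simp add: rtrancl.rtrancl_into_rtrancl)
    qed simp
    then have from0: "(z' 0, x) \<in> E\<^sup>*" if "x \<in> pverts G" for x
      using that z'(1) by (metis imageE lessThan_iff)
    then have "(x, y) \<in> E\<^sup>*" if "x \<in> pverts G" "y \<in> pverts G" for x y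
      using that sym_rtrancl[OF E(1)] by (meson rtrancl_trans symD)
    then show ?thesis
      using E ne by (subst connected_with_proj_iff) (simp_all add: delete_edge_def E_def)
  qed
  then show ?thesis
    unfolding two_edge_connected_def
    using G conn ne card k connected_with_proj_iff[OF arcs(2,3)] by auto
qed

text \<open>Pebbles are numbered from \<open>1\<close>, which frees \<open>0\<close> to mark empty
  vertices. For a configuration, points outside the graph also get \<open>0\<close>; hence holes are
  counted only within \<open>pverts G\<close>.\<close>

definition content :: "nat \<Rightarrow> (nat \<Rightarrow> 'a) \<Rightarrow> 'a \<Rightarrow> nat" where
  "content p S v = (if v \<in> S ` {1..p} then the_inv_into {1..p} S v else 0)"

lemma configs_inj: "S \<in> configs G p \<Longrightarrow> i \<in> {1..p} \<Longrightarrow> j \<in> {1..p} \<Longrightarrow> S i = S j \<Longrightarrow> i = j"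
  unfolding configs_def by (blast dest: inj_onD)

lemma content_apply: "S \<in> configs G p \<Longrightarrow> i \<in> {1..p} \<Longrightarrow> content p S (S i) = i"
  by (simp add: content_def configs_def the_inv_into_f_f)

lemma content_eq_0_iff:
  assumes "S \<in> configs G p"
  shows "content p S v = 0 \<longleftrightarrow> v \<notin> S ` {1..p}"
proof (cases "v \<in> S ` {1..p}")
  case True
  then obtain i where "i \<in> {1..p}" "v = S i" by blast
  then show ?thesis using content_apply[OF assms] True by simp
qed (simp add: content_def)

lemma content_eqD:
  assumes "S \<in> configs G p" "content p S v = i" "i \<noteq> 0"
  shows "i \<in> {1..p}" "S i = v"
proof -
  have "v \<in> S ` {1..p}" using assms(2,3) content_eq_0_iff[OF assms(1), of v] by simp
  then obtain j where "j \<in> {1..p}" "v = S j" by blast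
  then show "i \<in> {1..p}" "S i = v" using content_apply[OF assms(1)] assms(2) by auto
qed

lemma content_update:
  assumes S: "S \<in> configs G p" and k: "k \<in> {1..p}" and x: "x \<notin> S ` {1..p}"
    and S': "S' \<in> configs G p" "S' k = x" "\<And>j. j \<in> {1..p} - {k} \<Longrightarrow> S' j = S j"
  shows "content p S' = content p S \<circ> transpose x (S k)"
proof
  fix v
  have Sk: "S k \<noteq> x" using k x by blast
  have inj: "S j \<noteq> S k" if "j \<in> {1..p} - {k}" for j
    using configs_inj[OF S] that k by blast
  consider "v = x" | "v = S k" | j where "j \<in> {1..p} - {k}" "v = S j"
    | "v \<notin> S ` {1..p}" "v \<noteq> x" using k by blast
  then show "content p S' v = (content p S \<circ> transpose x (S k)) v"
  proof cases
    case 1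
    then show ?thesis using content_apply[OF S k] content_apply[OF S'(1) k] S'(2) by simp
  next
    case 2
    have "S k \<notin> S' ` {1..p}"
    proof
      assume "S k \<in> S' ` {1..p}"
      then obtain j where "j \<in> {1..p}" "S k = S' j" by blast
      then show False using S'(2,3) inj Sk by (cases "j = k") auto
    qed
    then have "content p S' v = 0" using content_eq_0_iff[OF S'(1), of v] 2 by simp
    moreover have "content p S x = 0" using content_eq_0_iff[OF S, of x] x by simp
    ultimately show ?thesis using 2 by simp
  next
    case 3
    then have "v \<noteq> x" "v \<noteq> S k" using x inj by auto
    then show ?thesis
      using 3 content_apply[OF S, of j] content_apply[OF S'(1), of j] S'(3)[of j] by simp
  next
    case 4
    then have "v \<noteq> S k" using k by blast
    have "v \<notin> S' ` {1..p}"
    proof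
      assume "v \<in> S' ` {1..p}"
      then obtain j where "j \<in> {1..p}" "v = S' j" by blast
      then show False using S'(2,3) 4 by (cases "j = k") auto
    qed
    then have "content p S' v = 0" using content_eq_0_iff[OF S'(1), of v] by simp
    moreover have "content p S v = 0" using content_eq_0_iff[OF S, of v] 4 by simp
    ultimately show ?thesis using 4 \<open>v \<noteq> S k\<close> by simp
  qed
qed

lemma moves_reach:
  assumes "(S, T) \<in> (moves G p)\<^sup>*" "sym (parcs G)"
  shows "reach (parcs G) (content p S) (content p T)"
  using assms(1)
proof (induction rule: rtrancl_induct)
  case (step T T')
  then obtain k where k: "T \<in> configs G p" "T' \<in> configs G p" "k \<in> {1..p}" "T k \<noteq> T' k"
    "\<And>j. j \<in> {1..p} - {k} \<Longrightarrow> T j = T' j" "(T k, T' k) \<in> parcs G"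
    by (auto simp: moves_def)
  \<comment> \<open>Injectivity of \<open>T'\<close> shows that the moving pebble enters an empty
    vertex; the hole then travels along the reverse arc.\<close>
  have x: "T' k \<notin> T ` {1..p}"
  proof
    assume "T' k \<in> T ` {1..p}"
    then obtain j where j: "j \<in> {1..p}" "T' k = T j" by blast
    then have "j \<noteq> k" using k(4) by auto
    then have "T' k = T' j" using j k(5) by simp
    then show False using configs_inj[OF k(2)] k(3) j(1) \<open>j \<noteq> k\<close> by blast
  qed
  have "content p T' = content p T \<circ> transpose (T' k) (T k)"
    using k x by (intro content_update) auto
  moreover have "content p T (T' k) = 0" using content_eq_0_iff[OF k(1), of "T' k"] x by simp
  moreover have "(T' k, T k) \<in> parcs G" using k(6) assms(2) by (auto dest: symD)
  ultimately have "reach (parcs G) (content p T) (content p T')" using reach_step by metis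
  then show ?case using step.IH by simp
qed simp

lemma reach_moves:
  assumes S: "S \<in> configs G p" and G: "sym (parcs G)" "parcs G \<subseteq> pverts G \<times> pverts G"
    and "reach (parcs G) (content p S) d"
  obtains T where "T \<in> configs G p" "(S, T) \<in> (moves G p)\<^sup>*" "d = content p T"
proof -
  have "\<exists>T. T \<in> configs G p \<and> (S, T) \<in> (moves G p)\<^sup>* \<and> d = content p T"
    using assms(4)
  proof (induction rule: rtrancl_induct)
    case base
    then show ?case using S by blast
  next
    case (step d d')
    then obtain T where T: "T \<in> configs G p" "(S, T) \<in> (moves G p)\<^sup>*" "d = content p T" by blast
    obtain x y where xy: "(x, y) \<in> parcs G" "d x = 0" "d' = d \<circ> transpose x y"
      using step.hyps(2) by (rule hole_stepE)
    show ?case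
    proof (cases "d y = 0")
      case True
      then have "d' = d" using xy by (auto simp: fun_eq_iff transpose_def)
      then show ?thesis using T by blast
    next
      case False
      define k where "k = d y"
      have k: "k \<in> {1..p}" "T k = y"
        using content_eqD[OF T(1), of y k] T(3) False by (auto simp: k_def)
      have x: "x \<notin> T ` {1..p}" using content_eq_0_iff[OF T(1), of x] xy(2) T(3) by simp
      have xV: "x \<in> pverts G" using xy(1) G(2) by auto
      define T' where "T' = T(k := x)"
      have T': "T' \<in> configs G p"
      proof -
        have "T' \<in> {1..p} \<rightarrow>\<^sub>E pverts G"
          using PiE_fun_upd[where T = "\<lambda>_. pverts G", OF xV, of T "{1..p}" k] T(1) insert_absorb[OF k(1)]
          by (simp add: configs_def T'_def)
        moreover have "inj_on T' {1..p}"
          unfolding T'_def using T(1) x by (intro inj_on_fun_updI) (auto simp: configs_def)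
        ultimately show ?thesis by (simp add: configs_def)
      qed
      have "content p T' = content p T \<circ> transpose x (T k)"
        using T(1) k(1) x T' by (rule content_update) (auto simp: T'_def)
      then have "d' = content p T'" using xy(3) T(3) k(2) by simp
      moreover have "(T, T') \<in> moves G p"
      proof -
        have "(y, x) \<in> parcs G" using xy(1) G(1) by (auto dest: symD)
        moreover have "y \<noteq> x" using k x by auto
        ultimately show ?thesis
          using T(1) T' k unfolding moves_def by (auto simp: T'_def intro!: bexI[of _ k])
      qed
      ultimately show ?thesis using T' rtrancl_into_rtrancl[OF T(2)] by blast
    qed
  qed
  then show ?thesis using that by blast
qed

section \<open>Feasible permutations and equivalent pebbles\<close>

theorem theorem6:
  fixes G :: "'a pair_pre_digraph" and n p :: nat
    and S :: "nat \<Rightarrow> 'a" and \<pi> :: "nat \<Rightarrow> nat"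
  assumes "pair_graph G"
    and "Digraph_Component.connected (with_proj G)"
    and "card (pverts G) = n"
    and "\<exists>H. max_two_edge_connected_component H G"
    and "\<not> max_two_edge_connected_component G G"
    and "S \<in> configs G p"
    and "\<pi> permutes {1..p}"
    and "feasible G p S \<pi>"
    and "p + 2 \<le> n"
  shows "\<forall>i\<in>{1..p}. pebble_equiv G p S i (\<pi> i)"
proof
  fix i assume i: "i \<in> {1..p}"
  note S = assms(6)
  note arcs = pair_graph_arcs[OF assms(1)]
  have conn: "(x, y) \<in> (parcs G)\<^sup>*" if "x \<in> pverts G" "y \<in> pverts G" for x y
    using iffD1[OF connected_with_proj_iff[OF arcs(2,3)] assms(2)] that by simp
  \<comment> \<open>A Hamiltonian cycle would make \<open>G\<close> 2-edge-connected and thus a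
    maximal 2-edge-connected component of itself.\<close>
  have no_hamilton: "z ` {..<k} \<noteq> pverts G" if "cycle_in (parcs G) z k" for z k
  proof
    assume "z ` {..<k} = pverts G"
    then have "two_edge_connected G"
      using hamiltonian_imp_two_edge_connected[OF assms(1) that] by simp
    moreover have "subgraph (with_proj G) (with_proj G)"
    proof -
      interpret pair_graph G by fact
      show ?thesis by (rule subgraph_refl)
    qed
    moreover have "H' = G" if "subgraph (with_proj H') (with_proj G)" "subgraph (with_proj G) (with_proj H')" for H'
      using that by (auto simp: subgraph_def intro!: pair_pre_digraph.equality)
    ultimately show False using assms(5) by (auto simp: max_two_edge_connected_component_def)
  qed
  interpret pebbling "parcs G" "content p S"
  proof
    show "inj_on (content p S) {v. content p S v \<noteq> 0}"
    proof (rule inj_onI)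
      fix v w
      assume "v \<in> {v. content p S v \<noteq> 0}" "content p S v = content p S w"
      then have "S (content p S v) = v" "S (content p S v) = w"
        using content_eqD(2)[OF S, of v "content p S v"] content_eqD(2)[OF S, of w "content p S v"]
        by simp_all
      then show "v = w" by simp
    qed
  qed (rule arcs(3))
  have "S ` {1..p} \<subseteq> pverts G" "card (S ` {1..p}) = p"
    using S by (auto simp: configs_def card_image)
  moreover have "holes (content p S) \<inter> pverts G = pverts G - S ` {1..p}"
    using content_eq_0_iff[OF S] by auto
  ultimately have "2 \<le> card (holes (content p S) \<inter> pverts G)"
    using assms(3,9) by (simp add: card_Diff_subset)
  then have rigid: "rigid (parcs G)"
    using rigid_graph[OF arcs(1,2) conn no_hamilton] by blast
  define D where "D = (\<lambda>i\<in>{1..p}. S (\<pi> i))"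
  have D: "D \<in> configs G p" "(S, D) \<in> (moves G p)\<^sup>*"
    using assms(8) by (auto simp: feasible_def config_connected_def D_def)
  have "D ` {1..p} = S ` {1..p}"
    using permutes_image[OF assms(7)] by (simp add: D_def image_image[symmetric, of S \<pi>])
  then have "holes (content p S) = holes (content p D)"
    using content_eq_0_iff[OF S] content_eq_0_iff[OF D(1)] by simp
  then have "congruent_mod (content p S) (content p D)"
    using rigidD[OF rigid] moves_reach[OF D(2) arcs(3)] by blast
  \<comment> \<open>The vertex \<open>S (\<pi> i)\<close> carries pebble \<open>\<pi> i\<close> in
    \<open>S\<close> and pebble \<open>i\<close> in \<open>D\<close>.\<close>
  then have "swappable (content p S (S (\<pi> i))) (content p D (D i))"
    using i by (simp add: congruent_mod_def D_def)
  moreover have \<pi>i: "\<pi> i \<in> {1..p}" using i permutes_in_image[OF assms(7)] by simp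
  ultimately have "swappable (\<pi> i) i"
    using content_apply[OF S] content_apply[OF D(1)] i by simp
  then have "swappable i (\<pi> i)" by (rule swappable_sym)
  then consider "i = \<pi> i" | "reach (parcs G) (content p S) (transpose i (\<pi> i) \<circ> content p S)"
    by (auto simp: swappable_def)
  then show "pebble_equiv G p S i (\<pi> i)"
  proof cases
    case 2
    obtain T where T: "T \<in> configs G p" "(S, T) \<in> (moves G p)\<^sup>*"
      "transpose i (\<pi> i) \<circ> content p S = content p T"
      using reach_moves[OF S arcs(3,2) 2] .
    \<comment> \<open>Exchanging two labels in \<open>content\<close> amounts to exchanging the
      positions of the two pebbles; this is read off at each vertex \<open>S j\<close>.\<close>
    have swapped: "T (transpose i (\<pi> i) j) = S j" if "j \<in> {1..p}" for j
    proof (rule content_eqD(2)[OF T(1)])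
      show "content p T (S j) = transpose i (\<pi> i) j"
        using content_apply[OF S that] by (simp flip: T(3))
      show "transpose i (\<pi> i) j \<noteq> 0" using i \<pi>i that by (auto simp: transpose_def)
    qed
    have "T k = S k" if "k \<in> {1..p} - {i, \<pi> i}" for k
      using swapped[of k] that by simp
    moreover have "T (\<pi> i) = S i" "T i = S (\<pi> i)"
      using swapped[OF i] swapped[OF \<pi>i] by simp_all
    ultimately show ?thesis
      using T(1,2) S unfolding pebble_equiv_def config_connected_def by blast
  qed (simp add: pebble_equiv_def)
qed

end
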